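(* Let $x=x_1,\dots,x_n$ be an $n$-tuple of elements in an $A$-algebra $R$. For each integer $i=1,\dots,n$ let $$x_{[i]}=x_1\otimes\cdots\otimes x_{i-1}\otimes x_{i+1}\otimes\cdots\otimes x_n\otimes1\quad\text{in}\quad\mathrm T^n_AR$$ denote the $n$-tensor obtained by removing the $i$-th factor and inserting $1$ as the last factor. Then for any $y\in\mathrm{TS}^{n-1,1}_AR$ we have the identity $$\alpha(x)\,y=\sum_{i=1}^n(-1)^{n-i}\alpha\big(x_{[i]}\,y\big)\varphi_n(x_i)\quad\text{in}\quad\mathrm T^n_AR.$$
   Context: All rings are commutative with unit; $n\ge1$. $\mathrm T^n_AR=R\otimes_A\cdots\otimes_AR$ ($n$ factors), and $\varphi_n:R\to\mathrm T^n_AR$ is the co-projection on the last factor. $\mathrm{TS}^{n-1,1}_AR=(\mathrm T^n_AR)^{\mathfrak S_{n-1}}$, where the symmetric group $\mathfrak S_{n-1}$ permutes the first $n-1$ factors. The alternator $\alpha:\mathrm T^n_AR\to\mathrm T^n_AR$ is the $A$-linear map determined by $\alpha(x_1\otimes\cdots\otimes x_n)=\sum_{\sigma\in\mathfrak S_n}(-1)^{|\sigma|}x_{\sigma(1)}\otimes\cdots\otimes x_{\sigma(n)}$, and $\alpha(x)$ means $\alpha(x_1\otimes\cdots\otimes x_n)$. *)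

theory Defs
  imports "HOL-Algebra.Free_Abelian_Groups" "HOL-Algebra.Generated_Groups"
    "HOL-Algebra.QuotRing" "HOL-Algebra.Module" "HOL-Combinatorics.Permutations"
begin

text \<open>
  The tensor power of an \<open>A\<close>-algebra \<open>R\<close> is the free abelian group on \<open>R\<^sup>n\<close> modulo the
  subgroup generated by the usual relations. The factors are indexed by \<open>{1..n}\<close>, and tuples are
  extensional functions. Everything is relative to the library locale \<open>algebra A R\<close>, which does
  not exclude zero rings.
\<close>

definition tuples :: "('r, 'k) ring_scheme \<Rightarrow> nat \<Rightarrow> (nat \<Rightarrow> 'r) set"
  where "tuples R n = {1..n} \<rightarrow>\<^sub>E carrier R"

text \<open>
  The integral monoid ring of the multiplicative monoid \<open>R\<^sup>n\<close>: its product is the biadditive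
  extension of the componentwise product of tuples.
\<close>

definition tuple_ring :: "('r, 'k) ring_scheme \<Rightarrow> nat \<Rightarrow> ((nat \<Rightarrow> 'r) \<Rightarrow>\<^sub>0 int) ring"
  where "tuple_ring R n =
    \<lparr>carrier = carrier (free_Abelian_group (tuples R n)),
     monoid.mult = (\<lambda>c d. frag_extend (\<lambda>u. frag_extend (\<lambda>v. frag_of (\<lambda>k\<in>{1..n}. u k \<otimes>\<^bsub>R\<^esub> v k)) d) c),
     one = frag_of (\<lambda>k\<in>{1..n}. \<one>\<^bsub>R\<^esub>),
     ring.zero = 0,
     add = (+)\<rparr>"

definition tensor_relations ::
    "('a, 'm) ring_scheme \<Rightarrow> ('a, 'r, 'k) module_scheme \<Rightarrow> nat \<Rightarrow> ((nat \<Rightarrow> 'r) \<Rightarrow>\<^sub>0 int) set"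
  where "tensor_relations A R n =
    {frag_of (u(i := r \<oplus>\<^bsub>R\<^esub> s)) - frag_of (u(i := r)) - frag_of (u(i := s)) | u i r s.
       u \<in> tuples R n \<and> i \<in> {1..n} \<and> r \<in> carrier R \<and> s \<in> carrier R} \<union>
    {frag_of (u(i := a \<odot>\<^bsub>R\<^esub> u i)) - frag_of (u(j := a \<odot>\<^bsub>R\<^esub> u j)) | u i j a.
       u \<in> tuples R n \<and> i \<in> {1..n} \<and> j \<in> {1..n} \<and> a \<in> carrier A}"

definition tensor_null ::
    "('a, 'm) ring_scheme \<Rightarrow> ('a, 'r, 'k) module_scheme \<Rightarrow> nat \<Rightarrow> ((nat \<Rightarrow> 'r) \<Rightarrow>\<^sub>0 int) set"
  where "tensor_null A R n =
    generate (free_Abelian_group (tuples R n)) (tensor_relations A R n)"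

definition pure_tensor ::
    "('a, 'm) ring_scheme \<Rightarrow> ('a, 'r, 'k) module_scheme \<Rightarrow> nat \<Rightarrow> (nat \<Rightarrow> 'r)
      \<Rightarrow> ((nat \<Rightarrow> 'r) \<Rightarrow>\<^sub>0 int) set"
  where "pure_tensor A R n x =
    tensor_null A R n +>\<^bsub>tuple_ring R n\<^esub> frag_of (restrict x {1..n})"

definition coprojection ::
    "('a, 'm) ring_scheme \<Rightarrow> ('a, 'r, 'k) module_scheme \<Rightarrow> nat \<Rightarrow> nat \<Rightarrow> 'r
      \<Rightarrow> ((nat \<Rightarrow> 'r) \<Rightarrow>\<^sub>0 int) set"
  where "coprojection A R n i r = pure_tensor A R n ((\<lambda>_. \<one>\<^bsub>R\<^esub>)(i := r))"

text \<open>
  Scalars act through the last factor; by the balancing relations the choice of factor does not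
  matter. The construction is meant for \<open>n \<ge> 1\<close> only.
\<close>

definition tensor_power ::
    "('a, 'm) ring_scheme \<Rightarrow> ('a, 'r, 'k) module_scheme \<Rightarrow> nat
      \<Rightarrow> ('a, ((nat \<Rightarrow> 'r) \<Rightarrow>\<^sub>0 int) set) module"
  where "tensor_power A R n = (let Q = tuple_ring R n Quot tensor_null A R n in
    \<lparr>carrier = carrier Q, monoid.mult = monoid.mult Q, one = \<one>\<^bsub>Q\<^esub>, ring.zero = \<zero>\<^bsub>Q\<^esub>, add = add Q,
     smult = (\<lambda>a t. coprojection A R n n (a \<odot>\<^bsub>R\<^esub> \<one>\<^bsub>R\<^esub>) \<otimes>\<^bsub>Q\<^esub> t)\<rparr>)"

text \<open>
  The elements of the tensor power are cosets of \<open>tensor_null\<close>, which is stable under permuting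
  the factors; hence a permutation acts on a coset by taking the image.
\<close>

definition frag_perm :: "(nat \<Rightarrow> nat) \<Rightarrow> ((nat \<Rightarrow> 'r) \<Rightarrow>\<^sub>0 int) \<Rightarrow> ((nat \<Rightarrow> 'r) \<Rightarrow>\<^sub>0 int)"
  where "frag_perm \<sigma> = frag_extend (\<lambda>u. frag_of (u \<circ> \<sigma>))"

definition tensor_perm ::
    "(nat \<Rightarrow> nat) \<Rightarrow> ((nat \<Rightarrow> 'r) \<Rightarrow>\<^sub>0 int) set \<Rightarrow> ((nat \<Rightarrow> 'r) \<Rightarrow>\<^sub>0 int) set"
  where "tensor_perm \<sigma> t = frag_perm \<sigma> ` t"

definition partial_symmetric_tensors ::
    "('a, 'm) ring_scheme \<Rightarrow> ('a, 'r, 'k) module_scheme \<Rightarrow> nat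
      \<Rightarrow> ((nat \<Rightarrow> 'r) \<Rightarrow>\<^sub>0 int) set set"
  where "partial_symmetric_tensors A R n =
    {t \<in> carrier (tensor_power A R n). \<forall>\<sigma>. \<sigma> permutes {1..n - 1} \<longrightarrow> tensor_perm \<sigma> t = t}"

definition alternator ::
    "('a, 'm) ring_scheme \<Rightarrow> ('a, 'r, 'k) module_scheme \<Rightarrow> nat
      \<Rightarrow> ((nat \<Rightarrow> 'r) \<Rightarrow>\<^sub>0 int) set \<Rightarrow> ((nat \<Rightarrow> 'r) \<Rightarrow>\<^sub>0 int) set"
  where "alternator A R n t =
    (\<Oplus>\<^bsub>tensor_power A R n\<^esub> \<sigma>\<in>{\<sigma>. \<sigma> permutes {1..n}}.
       [sign \<sigma>] \<cdot>\<^bsub>tensor_power A R n\<^esub> tensor_perm \<sigma> t)"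

definition omit_append_one :: "('r, 'k) ring_scheme \<Rightarrow> nat \<Rightarrow> nat \<Rightarrow> (nat \<Rightarrow> 'r) \<Rightarrow> nat \<Rightarrow> 'r"
  where "omit_append_one R n i x =
    (\<lambda>j. if j < i then x j else if j < n then x (j + 1) else \<one>\<^bsub>R\<^esub>)"


subsection \<open>The definitions are sound\<close>

lemma frag_extend_fun_diff:
  "frag_extend (\<lambda>u. f u - g u) c = frag_extend f c - frag_extend g c"
proof -
  have "frag_cmul k (a - b) = frag_cmul k a - frag_cmul k b" for k and a b :: "'a \<Rightarrow>\<^sub>0 int"
    by (rule poly_mapping_eqI) (simp add: lookup_minus algebra_simps)
  then show ?thesis
    by (simp add: frag_extend_def sum_subtractf)
qed

lemma frag_extend_fun_zero: "frag_extend (\<lambda>u. 0) c = 0"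
  by (simp add: frag_extend_def)

lemma tuples_comp:
  assumes "u \<in> tuples R n" and "\<sigma> permutes {1..n}"
  shows "u \<circ> \<sigma> \<in> tuples R n"
proof (unfold tuples_def, rule PiE_I)
  fix k assume "k \<in> {1..n}"
  then show "(u \<circ> \<sigma>) k \<in> carrier R"
    using assms permutes_in_image[OF assms(2), of k] by (auto simp: tuples_def)
next
  fix k assume "k \<notin> {1..n}"
  then show "(u \<circ> \<sigma>) k = undefined"
    using assms by (auto simp: tuples_def permutes_not_in)
qed

lemma frag_perm_of [simp]: "frag_perm \<sigma> (frag_of u) = frag_of (u \<circ> \<sigma>)"
  by (simp add: frag_perm_def)

lemma frag_perm_zero [simp]: "frag_perm \<sigma> 0 = 0"
  by (simp add: frag_perm_def)

lemma frag_perm_add: "frag_perm \<sigma> (c + d) = frag_perm \<sigma> c + frag_perm \<sigma> d"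
  by (simp add: frag_perm_def frag_extend_add)

lemma frag_perm_diff: "frag_perm \<sigma> (c - d) = frag_perm \<sigma> c - frag_perm \<sigma> d"
  by (simp add: frag_perm_def frag_extend_diff)

lemma frag_perm_comp: "frag_perm \<sigma> (frag_perm \<tau> c) = frag_perm (\<tau> \<circ> \<sigma>) c"
  by (induction c rule: frag_induction[where S = UNIV, OF subset_UNIV])
    (simp_all only: frag_perm_zero frag_perm_of frag_perm_diff o_assoc)

lemma frag_perm_id: "frag_perm id c = c"
  by (induction c rule: frag_induction[where S = UNIV, OF subset_UNIV])
    (simp_all only: frag_perm_zero frag_perm_of frag_perm_diff comp_id)

context
  fixes A :: "('a, 'm) ring_scheme" and R :: "('a, 'r, 'k) module_scheme" and n :: nat
  assumes alg: "algebra A R" and n: "1 \<le> n"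
begin

interpretation R: algebra A R by (rule alg)

private abbreviation (input) "TR \<equiv> tuple_ring R n"
private abbreviation (input) "TP \<equiv> tensor_power A R n"
private abbreviation (input) "N \<equiv> tensor_null A R n"

private abbreviation (input) tmult where "tmult u v \<equiv> (\<lambda>k\<in>{1..n}. u k \<otimes>\<^bsub>R\<^esub> v k)"

lemma tmult_closed: "\<lbrakk>u \<in> tuples R n; v \<in> tuples R n\<rbrakk> \<Longrightarrow> tmult u v \<in> tuples R n"
  by (auto simp: tuples_def)

lemma tuples_upd: "\<lbrakk>u \<in> tuples R n; i \<in> {1..n}; r \<in> carrier R\<rbrakk> \<Longrightarrow> u(i := r) \<in> tuples R n"
  by (auto simp: tuples_def PiE_iff extensional_def)

lemma tuple_induct [consumes 1, case_names zero diff single]: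
  assumes "Poly_Mapping.keys c \<subseteq> tuples R n" and "P 0"
    and "\<And>c d. \<lbrakk>Poly_Mapping.keys c \<subseteq> tuples R n; Poly_Mapping.keys d \<subseteq> tuples R n; P c; P d\<rbrakk>
      \<Longrightarrow> P (c - d)"
    and "\<And>u. u \<in> tuples R n \<Longrightarrow> P (frag_of u)"
  shows "P c"
  using assms by (rule free_Abelian_group_induct)

lemma tuple_ring_simps:
  "carrier TR = {c. Poly_Mapping.keys c \<subseteq> tuples R n}"
  "\<zero>\<^bsub>TR\<^esub> = 0" "c \<oplus>\<^bsub>TR\<^esub> d = c + d" "\<one>\<^bsub>TR\<^esub> = frag_of (\<lambda>k\<in>{1..n}. \<one>\<^bsub>R\<^esub>)"
  by (auto simp: tuple_ring_def)

lemma tuple_mult_of: "frag_of u \<otimes>\<^bsub>TR\<^esub> frag_of v = frag_of (tmult u v)"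
  by (simp add: tuple_ring_def)

lemma tuple_mult_zero: "0 \<otimes>\<^bsub>TR\<^esub> d = 0" "d \<otimes>\<^bsub>TR\<^esub> 0 = 0"
  by (simp_all add: tuple_ring_def frag_extend_fun_zero)

lemma tuple_mult_diff:
  "(c - d) \<otimes>\<^bsub>TR\<^esub> e = c \<otimes>\<^bsub>TR\<^esub> e - d \<otimes>\<^bsub>TR\<^esub> e"
  "e \<otimes>\<^bsub>TR\<^esub> (c - d) = e \<otimes>\<^bsub>TR\<^esub> c - e \<otimes>\<^bsub>TR\<^esub> d"
  by (simp_all add: tuple_ring_def frag_extend_diff frag_extend_fun_diff)

lemma tuple_mult_add:
  "(c + d) \<otimes>\<^bsub>TR\<^esub> e = c \<otimes>\<^bsub>TR\<^esub> e + d \<otimes>\<^bsub>TR\<^esub> e"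
  "e \<otimes>\<^bsub>TR\<^esub> (c + d) = e \<otimes>\<^bsub>TR\<^esub> c + e \<otimes>\<^bsub>TR\<^esub> d"
  using tuple_mult_diff(1)[of "c + d" d e] tuple_mult_diff(2)[of e "c + d" d] by simp_all

lemma keys_diff_subset:
  "\<lbrakk>Poly_Mapping.keys c \<subseteq> S; Poly_Mapping.keys d \<subseteq> S\<rbrakk> \<Longrightarrow> Poly_Mapping.keys (c - d) \<subseteq> S"
  using keys_diff[of c d] by blast

lemma keys_add_subset:
  "\<lbrakk>Poly_Mapping.keys c \<subseteq> S; Poly_Mapping.keys d \<subseteq> S\<rbrakk> \<Longrightarrow> Poly_Mapping.keys (c + d) \<subseteq> S"
  using keys_add[of c d] by blast

lemma tuple_mult_closed:
  assumes "Poly_Mapping.keys c \<subseteq> tuples R n" and "Poly_Mapping.keys d \<subseteq> tuples R n"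
  shows "Poly_Mapping.keys (c \<otimes>\<^bsub>TR\<^esub> d) \<subseteq> tuples R n"
  using assms(1)
proof (induction c rule: tuple_induct)
  case (single u)
  show ?case
    using assms(2)
    by (induction d rule: tuple_induct)
      (use single in \<open>simp_all only: tuple_mult_zero tuple_mult_diff tuple_mult_of keys_diff_subset,
        simp_all add: tmult_closed del: One_nat_def\<close>)
qed (simp_all add: tuple_mult_zero tuple_mult_diff keys_diff_subset)

lemma tuple_mult_comm:
  assumes "Poly_Mapping.keys c \<subseteq> tuples R n" and "Poly_Mapping.keys d \<subseteq> tuples R n"
  shows "c \<otimes>\<^bsub>TR\<^esub> d = d \<otimes>\<^bsub>TR\<^esub> c"
  using assms(1)
proof (induction c rule: tuple_induct)
  case (single u)
  show ?case
    using assms(2)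
  proof (induction d rule: tuple_induct)
    case (single v)
    have "tmult u v = tmult v u"
      using single \<open>u \<in> tuples R n\<close> by (intro restrict_ext R.m_comm) (auto simp: tuples_def)
    then show ?case by (simp only: tuple_mult_of)
  qed (simp_all add: tuple_mult_zero tuple_mult_diff)
qed (simp_all add: tuple_mult_zero tuple_mult_diff)

lemma tuple_mult_assoc:
  assumes "Poly_Mapping.keys c \<subseteq> tuples R n" and "Poly_Mapping.keys d \<subseteq> tuples R n"
    and "Poly_Mapping.keys e \<subseteq> tuples R n"
  shows "(c \<otimes>\<^bsub>TR\<^esub> d) \<otimes>\<^bsub>TR\<^esub> e = c \<otimes>\<^bsub>TR\<^esub> (d \<otimes>\<^bsub>TR\<^esub> e)"
  using assms(1)
proof (induction c rule: tuple_induct)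
  case (single u)
  show ?case
    using assms(2)
  proof (induction d rule: tuple_induct)
    case (single v)
    show ?case
      using assms(3)
    proof (induction e rule: tuple_induct)
      case (single w)
      have "tmult (tmult u v) w = tmult u (tmult v w)"
      proof (rule restrict_ext)
        fix k assume k: "k \<in> {1..n}"
        then have "u k \<in> carrier R" "v k \<in> carrier R" "w k \<in> carrier R"
          using single \<open>u \<in> tuples R n\<close> \<open>v \<in> tuples R n\<close> by (auto simp: tuples_def)
        then show "tmult u v k \<otimes>\<^bsub>R\<^esub> w k = u k \<otimes>\<^bsub>R\<^esub> tmult v w k"
          using k by (simp add: R.m_assoc)
      qed
      then show ?case by (simp only: tuple_mult_of)
    qed (simp_all add: tuple_mult_zero tuple_mult_diff)
  qed (simp_all add: tuple_mult_zero tuple_mult_diff)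
qed (simp_all add: tuple_mult_zero tuple_mult_diff)

lemma one_tuple: "(\<lambda>k\<in>{1..n}. \<one>\<^bsub>R\<^esub>) \<in> tuples R n"
  by (auto simp: tuples_def)

lemma tuple_mult_one:
  assumes "Poly_Mapping.keys c \<subseteq> tuples R n"
  shows "\<one>\<^bsub>TR\<^esub> \<otimes>\<^bsub>TR\<^esub> c = c"
  using assms
proof (induction c rule: tuple_induct)
  case (single u)
  then have "tmult (\<lambda>k\<in>{1..n}. \<one>\<^bsub>R\<^esub>) u = u"
    by (auto simp: tuples_def PiE_iff extensional_def fun_eq_iff)
  then show ?case
    by (simp only: tuple_ring_simps tuple_mult_of)
qed (simp_all add: tuple_mult_zero tuple_mult_diff)

lemma tuple_ring_cring: "cring TR"
proof (rule cringI)
  show "abelian_group TR"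
  proof (rule abelian_groupI)
    fix c assume "c \<in> carrier TR"
    then show "\<exists>d\<in>carrier TR. d \<oplus>\<^bsub>TR\<^esub> c = \<zero>\<^bsub>TR\<^esub>"
      by (intro bexI[of _ "- c"]) (auto simp: tuple_ring_simps)
  qed (auto simp: tuple_ring_simps keys_add_subset algebra_simps dest: subsetD[OF keys_add])
  show "comm_monoid TR"
    by (rule comm_monoidI)
      (auto simp: tuple_ring_simps(1,4) tuple_mult_assoc tuple_mult_one[unfolded tuple_ring_simps(4)]
        one_tuple intro: tuple_mult_comm dest: subsetD[OF tuple_mult_closed] simp del: One_nat_def)
qed (simp add: tuple_ring_simps tuple_mult_add)


lemma tensor_relations_cases [consumes 1, case_names add smult]:
  assumes "c \<in> tensor_relations A R n"
  obtains
    u i r s where "u \<in> tuples R n" "i \<in> {1..n}" "r \<in> carrier R" "s \<in> carrier R"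
      "c = frag_of (u(i := r \<oplus>\<^bsub>R\<^esub> s)) - frag_of (u(i := r)) - frag_of (u(i := s))"
  | u i j a where "u \<in> tuples R n" "i \<in> {1..n}" "j \<in> {1..n}" "a \<in> carrier A"
      "c = frag_of (u(i := a \<odot>\<^bsub>R\<^esub> u i)) - frag_of (u(j := a \<odot>\<^bsub>R\<^esub> u j))"
  using assms unfolding tensor_relations_def by blast

lemma tensor_relations_add:
  "\<lbrakk>u \<in> tuples R n; i \<in> {1..n}; r \<in> carrier R; s \<in> carrier R\<rbrakk> \<Longrightarrow>
    frag_of (u(i := r \<oplus>\<^bsub>R\<^esub> s)) - frag_of (u(i := r)) - frag_of (u(i := s))
      \<in> tensor_relations A R n"
  unfolding tensor_relations_def by blast

lemma tensor_relations_smult: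
  "\<lbrakk>u \<in> tuples R n; i \<in> {1..n}; j \<in> {1..n}; a \<in> carrier A\<rbrakk> \<Longrightarrow>
    frag_of (u(i := a \<odot>\<^bsub>R\<^esub> u i)) - frag_of (u(j := a \<odot>\<^bsub>R\<^esub> u j))
      \<in> tensor_relations A R n"
  unfolding tensor_relations_def by blast

lemma tuples_nth: "\<lbrakk>u \<in> tuples R n; i \<in> {1..n}\<rbrakk> \<Longrightarrow> u i \<in> carrier R"
  unfolding tuples_def by (rule PiE_mem)

lemma tensor_relations_keys:
  assumes "c \<in> tensor_relations A R n"
  shows "Poly_Mapping.keys c \<subseteq> tuples R n"
  using assms
proof (cases rule: tensor_relations_cases)
  case (add u i r s)
  have "u(i := r \<oplus>\<^bsub>R\<^esub> s) \<in> tuples R n" "u(i := r) \<in> tuples R n" "u(i := s) \<in> tuples R n"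
    using add(1-4) by (auto intro!: tuples_upd)
  then show ?thesis
    unfolding add(5) by (intro keys_diff_subset) simp_all
next
  case (smult u i j a)
  have "u(i := a \<odot>\<^bsub>R\<^esub> u i) \<in> tuples R n" "u(j := a \<odot>\<^bsub>R\<^esub> u j) \<in> tuples R n"
    using smult(1-4) by (auto intro!: tuples_upd R.smult_closed intro: tuples_nth)
  then show ?thesis
    unfolding smult(5) by (intro keys_diff_subset) simp_all
qed

lemma tensor_null_keys: "c \<in> N \<Longrightarrow> Poly_Mapping.keys c \<subseteq> tuples R n"
  unfolding tensor_null_def
  using group.generate_in_carrier[OF group_free_Abelian_group, of "tensor_relations A R n" "tuples R n" c]
    tensor_relations_keys by (auto simp: subset_iff)

lemma tensor_null_subgroup: "subgroup N (free_Abelian_group (tuples R n))"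
  unfolding tensor_null_def
  by (rule group.generate_is_subgroup) (use tensor_relations_keys in auto)

lemma tensor_null_zero: "0 \<in> N"
  using subgroup.one_closed[OF tensor_null_subgroup] by simp

lemma tensor_null_add: "\<lbrakk>c \<in> N; d \<in> N\<rbrakk> \<Longrightarrow> c + d \<in> N"
  using subgroup.m_closed[OF tensor_null_subgroup, of c d] by simp

lemma tensor_null_minus: "c \<in> N \<Longrightarrow> - c \<in> N"
  using subgroup.m_inv_closed[OF tensor_null_subgroup, of c] tensor_null_keys[of c] by simp

lemma tensor_null_diff: "\<lbrakk>c \<in> N; d \<in> N\<rbrakk> \<Longrightarrow> c - d \<in> N"
  using tensor_null_add[of c "- d"] tensor_null_minus by simp

lemma tensor_null_rel: "c \<in> tensor_relations A R n \<Longrightarrow> c \<in> N"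
  unfolding tensor_null_def by (rule generate.incl)

lemma tensor_null_induct [consumes 1, case_names zero rel diff]:
  assumes "c \<in> N" and zero: "P 0" and rel: "\<And>c. c \<in> tensor_relations A R n \<Longrightarrow> P c"
    and diff: "\<And>c d. \<lbrakk>c \<in> N; d \<in> N; P c; P d\<rbrakk> \<Longrightarrow> P (c - d)"
  shows "P c"
proof -
  have *: "c \<in> N \<and> P c" if "c \<in> generate (free_Abelian_group (tuples R n)) (tensor_relations A R n)" for c
    using that
  proof (induction c rule: generate.induct)
    case one
    then show ?case by (simp add: zero tensor_null_zero)
  next
    case (incl h)
    then show ?case by (simp add: rel tensor_null_rel)
  next
    case (inv h)
    then show ?case
      using diff[of 0 h] zero rel tensor_null_zero tensor_null_rel[OF inv] tensor_null_minus
      by (simp add: tensor_relations_keys)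
  next
    case (eng h1 h2)
    have "- h2 \<in> N \<and> P (- h2)"
      using diff[of 0 h2] eng.IH zero tensor_null_zero tensor_null_minus by simp
    then show ?case
      using diff[of h1 "- h2"] eng.IH tensor_null_add by simp
  qed
  show ?thesis
    using * assms(1) unfolding tensor_null_def by blast
qed

lemma tmult_upd:
  assumes "u \<in> tuples R n" "v \<in> tuples R n" "i \<in> {1..n}"
  shows "tmult v (u(i := r)) = (tmult v u)(i := v i \<otimes>\<^bsub>R\<^esub> r)"
  using assms(3) by (auto simp: fun_eq_iff)

lemma tensor_relations_mult:
  assumes "c \<in> tensor_relations A R n" and v: "v \<in> tuples R n"
  shows "frag_of v \<otimes>\<^bsub>TR\<^esub> c \<in> tensor_relations A R n"
  using assms(1)
proof (cases rule: tensor_relations_cases)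
  case (add u i r s)
  have "v i \<in> carrier R" by (rule tuples_nth[OF v add(2)])
  then show ?thesis
    using tensor_relations_add[OF tmult_closed[OF v add(1)] add(2), of "v i \<otimes>\<^bsub>R\<^esub> r" "v i \<otimes>\<^bsub>R\<^esub> s"] add(3,4)
    unfolding add(5) tuple_mult_diff tuple_mult_of tmult_upd[OF add(1) v add(2)]
    by (simp add: R.r_distr del: One_nat_def)
next
  case (smult u i j a)
  have [simp]: "v k \<otimes>\<^bsub>R\<^esub> (a \<odot>\<^bsub>R\<^esub> u k) = a \<odot>\<^bsub>R\<^esub> tmult v u k" if "k \<in> {1..n}" for k
    using that tuples_nth[OF v that] tuples_nth[OF smult(1) that] smult(4)
      R.smult_assoc2[of a "u k" "v k"]
    by (simp add: R.m_comm del: One_nat_def)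
  show ?thesis
    using tensor_relations_smult[OF tmult_closed[OF v smult(1)] smult(2,3,4)]
    unfolding smult(5) tuple_mult_diff tuple_mult_of tmult_upd[OF smult(1) v smult(2)]
      tmult_upd[OF smult(1) v smult(3)]
    using smult(2,3) by (simp del: One_nat_def)
qed

lemma tensor_null_mult:
  assumes "c \<in> N" and "Poly_Mapping.keys d \<subseteq> tuples R n"
  shows "d \<otimes>\<^bsub>TR\<^esub> c \<in> N"
  using assms(2)
proof (induction d rule: tuple_induct)
  case (single v)
  show ?case
    using assms(1)
  proof (induction c rule: tensor_null_induct)
    case (rel c)
    then show ?case using tensor_relations_mult[OF rel single] tensor_null_rel by blast
  qed (simp_all add: tuple_mult_zero tuple_mult_diff tensor_null_zero tensor_null_diff)
qed (simp_all add: tuple_mult_zero tuple_mult_diff tensor_null_zero tensor_null_diff)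

lemma tensor_null_ideal: "ideal N TR"
proof (rule idealI)
  show "ring TR" using tuple_ring_cring by (rule cring.axioms)
  have "add_monoid TR = free_Abelian_group (tuples R n)"
    by (simp add: tuple_ring_def free_Abelian_group_def)
  then show "subgroup N (add_monoid TR)"
    using tensor_null_subgroup by simp
next
  fix c d assume cd: "c \<in> N" "d \<in> carrier TR"
  then have k: "Poly_Mapping.keys c \<subseteq> tuples R n" "Poly_Mapping.keys d \<subseteq> tuples R n"
    using tensor_null_keys by (auto simp: tuple_ring_simps)
  show "d \<otimes>\<^bsub>TR\<^esub> c \<in> N" by (rule tensor_null_mult) fact+
  then show "c \<otimes>\<^bsub>TR\<^esub> d \<in> N" using tuple_mult_comm[OF k] by simp
qed

lemma tensor_power_simps:
  "carrier TP = carrier (TR Quot N)" "monoid.mult TP = monoid.mult (TR Quot N)"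
  "\<one>\<^bsub>TP\<^esub> = \<one>\<^bsub>TR Quot N\<^esub>" "\<zero>\<^bsub>TP\<^esub> = \<zero>\<^bsub>TR Quot N\<^esub>" "add TP = add (TR Quot N)"
  "a \<odot>\<^bsub>TP\<^esub> t = coprojection A R n n (a \<odot>\<^bsub>R\<^esub> \<one>\<^bsub>R\<^esub>) \<otimes>\<^bsub>TP\<^esub> t"
  by (simp_all add: tensor_power_def Let_def)

lemma tensor_power_cring: "cring TP"
proof -
  interpret Q: cring "TR Quot N"
    using ideal.quotient_is_cring[OF tensor_null_ideal tuple_ring_cring] .
  show ?thesis
  proof (rule cringI)
    show "abelian_group TP"
    proof (rule abelian_groupI)
      fix t assume "t \<in> carrier TP"
      then show "\<exists>s\<in>carrier TP. s \<oplus>\<^bsub>TP\<^esub> t = \<zero>\<^bsub>TP\<^esub>"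
        by (intro bexI[of _ "\<ominus>\<^bsub>TR Quot N\<^esub> t"]) (simp_all only: tensor_power_simps Q.l_neg Q.a_inv_closed)
    qed (simp_all only: tensor_power_simps, simp_all add: Q.a_assoc, rule Q.a_comm)
    show "comm_monoid TP"
      by (rule comm_monoidI)
        (simp_all only: tensor_power_simps, simp_all add: Q.m_assoc, rule Q.m_comm)
  qed (simp only: tensor_power_simps Q.l_distr)
qed

private abbreviation (input) cls where "cls c \<equiv> N +>\<^bsub>TR\<^esub> c"

interpretation I: ideal N TR by (rule tensor_null_ideal)
interpretation T: cring TP by (rule tensor_power_cring)

lemma tensor_power_carrier: "carrier TP = cls ` carrier TR"
  unfolding tensor_power_simps FactRing_def A_RCOSETS_def' by auto

lemma tensor_power_coset_closed: "c \<in> carrier TR \<Longrightarrow> cls c \<in> carrier TP"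
  by (simp add: tensor_power_carrier)

lemma tensor_power_add:
  "\<lbrakk>c \<in> carrier TR; d \<in> carrier TR\<rbrakk> \<Longrightarrow> cls c \<oplus>\<^bsub>TP\<^esub> cls d = cls (c + d)"
  using ring_hom_add[OF I.rcos_ring_hom, of c d] by (simp add: tensor_power_simps tuple_ring_simps)

lemma tensor_power_mult:
  "\<lbrakk>c \<in> carrier TR; d \<in> carrier TR\<rbrakk> \<Longrightarrow> cls c \<otimes>\<^bsub>TP\<^esub> cls d = cls (c \<otimes>\<^bsub>TR\<^esub> d)"
  using ring_hom_mult[OF I.rcos_ring_hom, of c d] by (simp add: tensor_power_simps)

lemma tensor_power_one: "\<one>\<^bsub>TP\<^esub> = cls (\<one>\<^bsub>TR\<^esub>)"
  by (simp add: tensor_power_simps FactRing_def)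

lemma tensor_power_coset: "cls c = {h + c | h. h \<in> N}"
  by (auto simp: a_r_coset_def' tuple_ring_simps)

lemma tensor_power_coset_eqI:
  assumes "c - d \<in> N" shows "cls c = cls d"
proof -
  have "\<exists>h'. h + c = h' + d \<and> h' \<in> N" "\<exists>h'. h + d = h' + c \<and> h' \<in> N" if "h \<in> N" for h
    using tensor_null_add[OF that assms] tensor_null_diff[OF that assms]
    by (auto intro: exI[of _ "h + (c - d)"] exI[of _ "h - (c - d)"])
  then show ?thesis by (auto simp: tensor_power_coset)
qed

lemma frag_of_carrier: "u \<in> tuples R n \<Longrightarrow> frag_of u \<in> carrier TR"
  by (simp add: tuple_ring_simps)

lemma restrict_tuples: "(\<And>i. i \<in> {1..n} \<Longrightarrow> x i \<in> carrier R) \<Longrightarrow> restrict x {1..n} \<in> tuples R n"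
  unfolding tuples_def by (rule restrict_PiE_iff[THEN iffD2]) blast

lemma tensor_power_induct [consumes 1, case_names diff pure]:
  assumes "t \<in> carrier TP"
    and diff: "\<And>s t. \<lbrakk>s \<in> carrier TP; t \<in> carrier TP; P s; P t\<rbrakk> \<Longrightarrow> P (s \<ominus>\<^bsub>TP\<^esub> t)"
    and pure: "\<And>x. (\<And>i. i \<in> {1..n} \<Longrightarrow> x i \<in> carrier R) \<Longrightarrow> P (pure_tensor A R n x)"
  shows "P t"
proof -
  obtain c where c: "Poly_Mapping.keys c \<subseteq> tuples R n" "t = cls c"
    using assms(1) by (auto simp: tensor_power_carrier tuple_ring_simps)
  have *: "P (cls (frag_of u))" if "u \<in> tuples R n" for u
  proof -
    have "restrict u {1..n} = u"
      using that unfolding tuples_def by (rule PiE_restrict)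
    then show ?thesis
      using pure[of u] tuples_nth[OF that] unfolding pure_tensor_def by simp
  qed
  have d: "cls c \<ominus>\<^bsub>TP\<^esub> cls d = cls (c - d)" if "c \<in> carrier TR" "d \<in> carrier TR" for c d
  proof -
    have cd: "c - d \<in> carrier TR"
      using that by (simp add: tuple_ring_simps keys_diff_subset)
    have "cls c = cls (c - d) \<oplus>\<^bsub>TP\<^esub> cls d"
      using tensor_power_add[OF cd that(2)] by simp
    then show ?thesis
      using that cd by (simp add: T.minus_eq T.a_assoc T.r_neg tensor_power_coset_closed)
  qed
  have dd: "P (cls (c - d))" if "c \<in> carrier TR" "d \<in> carrier TR" "P (cls c)" "P (cls d)" for c d
    using diff[of "cls c" "cls d"] d that by (simp add: tensor_power_coset_closed)
  have "P (cls c)"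
    using c(1)
  proof (induction c rule: tuple_induct)
    case zero
    show ?case
      using dd[OF _ _ *[OF one_tuple] *[OF one_tuple]] frag_of_carrier[OF one_tuple] by simp
  next
    case (diff c d)
    then show ?case using dd by (simp add: tuple_ring_simps)
  qed (rule *)
  then show ?thesis using c by simp
qed

lemma pure_tensor_closed:
  "(\<And>i. i \<in> {1..n} \<Longrightarrow> x i \<in> carrier R) \<Longrightarrow> pure_tensor A R n x \<in> carrier TP"
  unfolding pure_tensor_def
  by (intro tensor_power_coset_closed frag_of_carrier restrict_tuples)

lemma restrict_upd: "i \<in> {1..n} \<Longrightarrow> restrict (x(i := r)) {1..n} = (restrict x {1..n})(i := r)"
  by (auto simp: fun_eq_iff)

lemma pure_tensor_add:
  assumes "\<And>i. i \<in> {1..n} \<Longrightarrow> x i \<in> carrier R" "i \<in> {1..n}" "r \<in> carrier R" "s \<in> carrier R"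
  shows "pure_tensor A R n (x(i := r \<oplus>\<^bsub>R\<^esub> s)) =
    pure_tensor A R n (x(i := r)) \<oplus>\<^bsub>TP\<^esub> pure_tensor A R n (x(i := s))"
proof -
  let ?u = "restrict x {1..n}"
  have u: "?u \<in> tuples R n" using assms(1) by (rule restrict_tuples)
  have "frag_of (?u(i := r \<oplus>\<^bsub>R\<^esub> s)) - (frag_of (?u(i := r)) + frag_of (?u(i := s))) \<in> N"
    using tensor_null_rel[OF tensor_relations_add[OF u assms(2-4)]] by (simp only: diff_diff_eq)
  from tensor_power_coset_eqI[OF this] show ?thesis
    unfolding pure_tensor_def restrict_upd[OF assms(2)]
    using tensor_power_add[OF frag_of_carrier frag_of_carrier, OF tuples_upd tuples_upd,
        OF u assms(2,3) u assms(2,4)] by simp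
qed

lemma pure_tensor_mult:
  assumes "\<And>i. i \<in> {1..n} \<Longrightarrow> x i \<in> carrier R" "\<And>i. i \<in> {1..n} \<Longrightarrow> y i \<in> carrier R"
  shows "pure_tensor A R n x \<otimes>\<^bsub>TP\<^esub> pure_tensor A R n y = pure_tensor A R n (\<lambda>i. x i \<otimes>\<^bsub>R\<^esub> y i)"
proof -
  have "tmult (restrict x {1..n}) (restrict y {1..n}) = restrict (\<lambda>i. x i \<otimes>\<^bsub>R\<^esub> y i) {1..n}"
    by (rule restrict_ext) (simp del: One_nat_def)
  then show ?thesis
    unfolding pure_tensor_def
    using tensor_power_mult[OF frag_of_carrier frag_of_carrier, OF restrict_tuples restrict_tuples,
        of x y] assms by (simp only: tuple_mult_of)
qed

lemma pure_tensor_cong: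
  "(\<And>i. i \<in> {1..n} \<Longrightarrow> x i = y i) \<Longrightarrow> pure_tensor A R n x = pure_tensor A R n y"
  unfolding pure_tensor_def by (metis restrict_ext)

lemma pure_tensor_one: "pure_tensor A R n (\<lambda>_. \<one>\<^bsub>R\<^esub>) = \<one>\<^bsub>TP\<^esub>"
  unfolding pure_tensor_def tensor_power_one tuple_ring_simps ..

lemma coprojection_ring_hom:
  assumes i: "i \<in> {1..n}"
  shows "coprojection A R n i \<in> ring_hom R TP"
proof (rule ring_hom_memI)
  show "coprojection A R n i \<one>\<^bsub>R\<^esub> = \<one>\<^bsub>TP\<^esub>"
    by (simp add: coprojection_def fun_upd_idem pure_tensor_one)
  fix r s assume rs: "r \<in> carrier R" "s \<in> carrier R"
  show "coprojection A R n i r \<in> carrier TP"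
    unfolding coprojection_def using rs by (intro pure_tensor_closed) auto
  show "coprojection A R n i (r \<oplus>\<^bsub>R\<^esub> s) = coprojection A R n i r \<oplus>\<^bsub>TP\<^esub> coprojection A R n i s"
    unfolding coprojection_def using rs i by (intro pure_tensor_add) auto
  have "(\<lambda>j. ((\<lambda>_. \<one>\<^bsub>R\<^esub>)(i := r)) j \<otimes>\<^bsub>R\<^esub> ((\<lambda>_. \<one>\<^bsub>R\<^esub>)(i := s)) j) = (\<lambda>_. \<one>\<^bsub>R\<^esub>)(i := r \<otimes>\<^bsub>R\<^esub> s)"
    using rs by auto
  then show "coprojection A R n i (r \<otimes>\<^bsub>R\<^esub> s) = coprojection A R n i r \<otimes>\<^bsub>TP\<^esub> coprojection A R n i s"
    unfolding coprojection_def using rs by (subst pure_tensor_mult) auto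
qed

lemma n_mem: "n \<in> {1..n}"
  using n by simp

lemma tensor_power_algebra: "algebra A TP"
proof -
  define h where "h a = coprojection A R n n (a \<odot>\<^bsub>R\<^esub> \<one>\<^bsub>R\<^esub>)" for a
  interpret C: ring_hom_ring R TP "coprojection A R n n"
    by (rule ring_hom_ringI2[OF R.ring_axioms T.ring_axioms coprojection_ring_hom[OF n_mem]])
  have h: "h a \<in> carrier TP" if "a \<in> carrier A" for a
    using that unfolding h_def by simp
  have h_mult: "h (a \<otimes>\<^bsub>A\<^esub> b) = h a \<otimes>\<^bsub>TP\<^esub> h b" if "a \<in> carrier A" "b \<in> carrier A" for a b
  proof -
    have "(a \<otimes>\<^bsub>A\<^esub> b) \<odot>\<^bsub>R\<^esub> \<one>\<^bsub>R\<^esub> = (a \<odot>\<^bsub>R\<^esub> \<one>\<^bsub>R\<^esub>) \<otimes>\<^bsub>R\<^esub> (b \<odot>\<^bsub>R\<^esub> \<one>\<^bsub>R\<^esub>)"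
      using that by (simp add: R.smult_assoc1 R.smult_assoc2)
    then show ?thesis using that by (simp add: h_def)
  qed
  have h_add: "h (a \<oplus>\<^bsub>A\<^esub> b) = h a \<oplus>\<^bsub>TP\<^esub> h b" if "a \<in> carrier A" "b \<in> carrier A" for a b
    using that by (simp add: h_def R.smult_l_distr)
  have h_one: "h \<one>\<^bsub>A\<^esub> = \<one>\<^bsub>TP\<^esub>"
    by (simp add: h_def)
  have sm: "a \<odot>\<^bsub>TP\<^esub> t = h a \<otimes>\<^bsub>TP\<^esub> t" for a t
    by (simp add: tensor_power_simps(6) h_def)
  show ?thesis
    by (rule algebraI)
      (simp_all add: sm h h_mult h_add h_one R.R_cring tensor_power_cring
        T.l_distr T.r_distr T.m_assoc)
qed

lemma pure_tensor_smult:
  assumes x: "\<And>i. i \<in> {1..n} \<Longrightarrow> x i \<in> carrier R" and "i \<in> {1..n}" "a \<in> carrier A"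
  shows "pure_tensor A R n (x(i := a \<odot>\<^bsub>R\<^esub> x i)) = a \<odot>\<^bsub>TP\<^esub> pure_tensor A R n x"
proof -
  let ?u = "restrict x {1..n}"
  have "pure_tensor A R n (x(i := a \<odot>\<^bsub>R\<^esub> x i)) = pure_tensor A R n (x(n := a \<odot>\<^bsub>R\<^esub> x n))"
    using tensor_power_coset_eqI[OF tensor_null_rel[OF tensor_relations_smult[OF
          restrict_tuples[OF x] assms(2) n_mem assms(3)]]]
    unfolding pure_tensor_def restrict_upd[OF assms(2)] restrict_upd[OF n_mem]
    using assms(2) n_mem by (simp del: One_nat_def atLeastAtMost_iff)
  also have "\<dots> = coprojection A R n n (a \<odot>\<^bsub>R\<^esub> \<one>\<^bsub>R\<^esub>) \<otimes>\<^bsub>TP\<^esub> pure_tensor A R n x"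
    unfolding coprojection_def
  proof (subst pure_tensor_mult)
    show "pure_tensor A R n (x(n := a \<odot>\<^bsub>R\<^esub> x n)) =
      pure_tensor A R n (\<lambda>i. ((\<lambda>_. \<one>\<^bsub>R\<^esub>)(n := a \<odot>\<^bsub>R\<^esub> \<one>\<^bsub>R\<^esub>)) i \<otimes>\<^bsub>R\<^esub> x i)"
      using x assms(3) by (intro pure_tensor_cong) (auto simp: R.smult_assoc2)
  qed (use x assms(3) in auto)
  finally show ?thesis by (simp add: tensor_power_simps(6))
qed


lemma upd_comp_perm:
  assumes "\<sigma> permutes {1..n}"
  shows "u(i := r) \<circ> \<sigma> = (u \<circ> \<sigma>)(inv_into UNIV \<sigma> i := r)"
  using permutes_inverses[OF assms] by (auto simp: fun_eq_iff)

lemma frag_perm_relations: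
  assumes c: "c \<in> tensor_relations A R n" and \<sigma>: "\<sigma> permutes {1..n}"
  shows "frag_perm \<sigma> c \<in> tensor_relations A R n"
proof -
  have m: "inv_into UNIV \<sigma> i \<in> {1..n}" if "i \<in> {1..n}" for i
    using permutes_in_image[OF permutes_inv[OF \<sigma>]] that by blast
  from c show ?thesis
  proof (cases rule: tensor_relations_cases)
    case (add u i r s)
    show ?thesis
      using tensor_relations_add[OF tuples_comp[OF add(1) \<sigma>] m[OF add(2)] add(3,4)]
      unfolding add(5) by (simp only: frag_perm_diff frag_perm_of upd_comp_perm[OF \<sigma>])
  next
    case (smult u i j a)
    show ?thesis
      using tensor_relations_smult[OF tuples_comp[OF smult(1) \<sigma>] m[OF smult(2)] m[OF smult(3)] smult(4)]
      unfolding smult(5)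
      by (simp only: frag_perm_diff frag_perm_of upd_comp_perm[OF \<sigma>] o_apply permutes_inverses[OF \<sigma>])
  qed
qed

lemma frag_perm_null:
  assumes c: "c \<in> N" and \<sigma>: "\<sigma> permutes {1..n}"
  shows "frag_perm \<sigma> c \<in> N"
  using c by (induction c rule: tensor_null_induct)
    (simp_all add: frag_perm_diff tensor_null_diff tensor_null_zero
      tensor_null_rel frag_perm_relations[OF _ \<sigma>])

lemma frag_perm_image_null:
  assumes \<sigma>: "\<sigma> permutes {1..n}"
  shows "frag_perm \<sigma> ` N = N"
proof
  show "frag_perm \<sigma> ` N \<subseteq> N" using frag_perm_null[OF _ \<sigma>] by blast
  show "N \<subseteq> frag_perm \<sigma> ` N"
  proof
    fix c assume "c \<in> N"
    then have "frag_perm (inv_into UNIV \<sigma>) c \<in> N" by (rule frag_perm_null[OF _ permutes_inv[OF \<sigma>]])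
    moreover have "c = frag_perm \<sigma> (frag_perm (inv_into UNIV \<sigma>) c)"
      by (simp only: frag_perm_comp permutes_inv_o[OF \<sigma>] frag_perm_id)
    ultimately show "c \<in> frag_perm \<sigma> ` N" by blast
  qed
qed

lemma tensor_perm_coset:
  assumes \<sigma>: "\<sigma> permutes {1..n}"
  shows "tensor_perm \<sigma> (cls c) = cls (frag_perm \<sigma> c)"
proof -
  have "frag_perm \<sigma> ` {h + c | h. h \<in> N} = {h + frag_perm \<sigma> c | h. h \<in> frag_perm \<sigma> ` N}"
    by (auto simp: frag_perm_add image_iff) (metis frag_perm_add)
  then show ?thesis
    by (simp only: tensor_perm_def tensor_power_coset frag_perm_image_null[OF \<sigma>])
qed

lemma frag_perm_closed:
  assumes c: "Poly_Mapping.keys c \<subseteq> tuples R n" and \<sigma>: "\<sigma> permutes {1..n}"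
  shows "Poly_Mapping.keys (frag_perm \<sigma> c) \<subseteq> tuples R n"
  using c by (induction c rule: tuple_induct)
    (simp_all add: frag_perm_diff keys_diff_subset tuples_comp[OF _ \<sigma>])

lemma frag_perm_mult:
  assumes c: "Poly_Mapping.keys c \<subseteq> tuples R n" and d: "Poly_Mapping.keys d \<subseteq> tuples R n"
    and \<sigma>: "\<sigma> permutes {1..n}"
  shows "frag_perm \<sigma> (c \<otimes>\<^bsub>TR\<^esub> d) = frag_perm \<sigma> c \<otimes>\<^bsub>TR\<^esub> frag_perm \<sigma> d"
  using c
proof (induction c rule: tuple_induct)
  case (single u)
  show ?case
    using d
  proof (induction d rule: tuple_induct)
    case (single v)
    have "tmult u v \<circ> \<sigma> = tmult (u \<circ> \<sigma>) (v \<circ> \<sigma>)"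
      using permutes_in_image[OF \<sigma>] by (auto simp: fun_eq_iff restrict_def)
    then show ?case by (simp only: tuple_mult_of frag_perm_of)
  qed (simp_all only: tuple_mult_zero tuple_mult_diff frag_perm_zero frag_perm_diff)
qed (simp_all only: tuple_mult_zero tuple_mult_diff frag_perm_zero frag_perm_diff)

lemma tensor_perm_pure:
  assumes \<sigma>: "\<sigma> permutes {1..n}"
  shows "tensor_perm \<sigma> (pure_tensor A R n x) = pure_tensor A R n (x \<circ> \<sigma>)"
proof -
  have "restrict x {1..n} \<circ> \<sigma> = restrict (x \<circ> \<sigma>) {1..n}"
    using permutes_in_image[OF \<sigma>] by (auto simp: fun_eq_iff restrict_def)
  then show ?thesis
    by (simp only: pure_tensor_def tensor_perm_coset[OF \<sigma>] frag_perm_of)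
qed

lemma tensor_perm_ring_hom:
  assumes \<sigma>: "\<sigma> permutes {1..n}"
  shows "tensor_perm \<sigma> \<in> ring_hom TP TP"
proof (rule ring_hom_memI)
  have cl: "frag_perm \<sigma> c \<in> carrier TR" if "c \<in> carrier TR" for c
    using that frag_perm_closed[OF _ \<sigma>] by (simp add: tuple_ring_simps)
  show "tensor_perm \<sigma> \<one>\<^bsub>TP\<^esub> = \<one>\<^bsub>TP\<^esub>"
    using tensor_perm_pure[OF \<sigma>, of "\<lambda>_. \<one>\<^bsub>R\<^esub>"] by (simp add: pure_tensor_one o_def)
  fix s t assume "s \<in> carrier TP" "t \<in> carrier TP"
  then obtain c d where c: "c \<in> carrier TR" "s = cls c" and d: "d \<in> carrier TR" "t = cls d"
    by (auto simp: tensor_power_carrier)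
  show "tensor_perm \<sigma> s \<in> carrier TP"
    by (simp add: c cl tensor_perm_coset[OF \<sigma>] tensor_power_coset_closed del: One_nat_def)
  have cd: "c \<otimes>\<^bsub>TR\<^esub> d \<in> carrier TR" "c + d \<in> carrier TR"
    using c d by (simp_all add: tuple_ring_simps tuple_mult_closed keys_add_subset)
  show "tensor_perm \<sigma> (s \<otimes>\<^bsub>TP\<^esub> t) = tensor_perm \<sigma> s \<otimes>\<^bsub>TP\<^esub> tensor_perm \<sigma> t"
    using frag_perm_mult[OF _ _ \<sigma>, of c d] c(1) d(1)
      tensor_power_mult[OF c(1) d(1)] tensor_power_mult[OF cl[OF c(1)] cl[OF d(1)]]
    by (simp add: c(2) d(2) tensor_perm_coset[OF \<sigma>] tuple_ring_simps(1))
  show "tensor_perm \<sigma> (s \<oplus>\<^bsub>TP\<^esub> t) = tensor_perm \<sigma> s \<oplus>\<^bsub>TP\<^esub> tensor_perm \<sigma> t"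
    using c(1) d(1)
    by (simp add: c(2) d(2) cl tensor_power_add tensor_perm_coset[OF \<sigma>] frag_perm_add)
qed

lemma tensor_perm_closed:
  "\<lbrakk>\<sigma> permutes {1..n}; t \<in> carrier TP\<rbrakk> \<Longrightarrow> tensor_perm \<sigma> t \<in> carrier TP"
  using ring_hom_closed[OF tensor_perm_ring_hom] .

lemma tensor_perm_smult:
  assumes \<sigma>: "\<sigma> permutes {1..n}" and t: "t \<in> carrier TP" and a: "a \<in> carrier A"
  shows "tensor_perm \<sigma> (a \<odot>\<^bsub>TP\<^esub> t) = a \<odot>\<^bsub>TP\<^esub> tensor_perm \<sigma> t"
proof -
  let ?e = "coprojection A R n n (a \<odot>\<^bsub>R\<^esub> \<one>\<^bsub>R\<^esub>)"
  have e: "?e \<in> carrier TP"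
    using ring_hom_closed[OF coprojection_ring_hom[OF n_mem]] a by simp
  have m: "inv_into UNIV \<sigma> n \<in> {1..n}"
    using permutes_in_image[OF permutes_inv[OF \<sigma>]] n_mem by blast
  have "tensor_perm \<sigma> ?e = pure_tensor A R n ((\<lambda>_. \<one>\<^bsub>R\<^esub>)(inv_into UNIV \<sigma> n := a \<odot>\<^bsub>R\<^esub> \<one>\<^bsub>R\<^esub>))"
    unfolding coprojection_def tensor_perm_pure[OF \<sigma>] upd_comp_perm[OF \<sigma>] by (simp add: o_def)
  also have "\<dots> = ?e"
    unfolding coprojection_def
    using pure_tensor_smult[of "\<lambda>_. \<one>\<^bsub>R\<^esub>", OF _ m a] pure_tensor_smult[of "\<lambda>_. \<one>\<^bsub>R\<^esub>", OF _ n_mem a]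
    by simp
  finally show ?thesis
    unfolding tensor_power_simps(6) using ring_hom_mult[OF tensor_perm_ring_hom[OF \<sigma>] e t] by simp
qed

lemma alternator_closed:
  assumes "t \<in> carrier TP" shows "alternator A R n t \<in> carrier TP"
  unfolding alternator_def by (rule T.finsum_closed) (use tensor_perm_closed assms in auto)

lemma alternator_pure_tensor:
  assumes x: "\<And>i. i \<in> {1..n} \<Longrightarrow> x i \<in> carrier R"
  shows "alternator A R n (pure_tensor A R n x) =
    (\<Oplus>\<^bsub>TP\<^esub> \<sigma>\<in>{\<sigma>. \<sigma> permutes {1..n}}. [sign \<sigma>] \<cdot>\<^bsub>TP\<^esub> pure_tensor A R n (x \<circ> \<sigma>))"
proof -
  have "pure_tensor A R n (x \<circ> \<sigma>) \<in> carrier TP" if "\<sigma> permutes {1..n}" for \<sigma>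
    using tensor_perm_closed[OF that pure_tensor_closed] tensor_perm_pure[OF that, of x] x
    by metis
  then show ?thesis
    unfolding alternator_def
    by (intro T.finsum_cong') (auto simp: tensor_perm_pure simp del: One_nat_def)
qed

lemma alternator_add:
  assumes "s \<in> carrier TP" "t \<in> carrier TP"
  shows "alternator A R n (s \<oplus>\<^bsub>TP\<^esub> t) = alternator A R n s \<oplus>\<^bsub>TP\<^esub> alternator A R n t"
proof -
  have cl: "tensor_perm \<sigma> s \<in> carrier TP" "tensor_perm \<sigma> t \<in> carrier TP" if "\<sigma> permutes {1..n}" for \<sigma>
    using tensor_perm_closed[OF that] assms by blast+
  have "alternator A R n (s \<oplus>\<^bsub>TP\<^esub> t) = (\<Oplus>\<^bsub>TP\<^esub> \<sigma>\<in>{\<sigma>. \<sigma> permutes {1..n}}.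
      [sign \<sigma>] \<cdot>\<^bsub>TP\<^esub> tensor_perm \<sigma> s \<oplus>\<^bsub>TP\<^esub> [sign \<sigma>] \<cdot>\<^bsub>TP\<^esub> tensor_perm \<sigma> t)"
    unfolding alternator_def
  proof (rule T.finsum_cong')
    fix \<sigma> assume "\<sigma> \<in> {\<sigma>. \<sigma> permutes {1..n}}"
    then have \<sigma>: "\<sigma> permutes {1..n}" by simp
    show "[sign \<sigma>] \<cdot>\<^bsub>TP\<^esub> tensor_perm \<sigma> (s \<oplus>\<^bsub>TP\<^esub> t) =
        [sign \<sigma>] \<cdot>\<^bsub>TP\<^esub> tensor_perm \<sigma> s \<oplus>\<^bsub>TP\<^esub> [sign \<sigma>] \<cdot>\<^bsub>TP\<^esub> tensor_perm \<sigma> t"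
      using T.add.int_pow_distrib[OF cl[OF \<sigma>]] ring_hom_add[OF tensor_perm_ring_hom[OF \<sigma>] assms]
      by simp
  qed (use cl in auto)
  also have "\<dots> = alternator A R n s \<oplus>\<^bsub>TP\<^esub> alternator A R n t"
    unfolding alternator_def by (rule T.finsum_addf) (use cl in auto)
  finally show ?thesis .
qed

lemma alternator_smult:
  assumes a: "a \<in> carrier A" and t: "t \<in> carrier TP"
  shows "alternator A R n (a \<odot>\<^bsub>TP\<^esub> t) = a \<odot>\<^bsub>TP\<^esub> alternator A R n t"
proof -
  let ?e = "coprojection A R n n (a \<odot>\<^bsub>R\<^esub> \<one>\<^bsub>R\<^esub>)"
  have e: "?e \<in> carrier TP"
    using ring_hom_closed[OF coprojection_ring_hom[OF n_mem]] a by simp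
  have cl: "tensor_perm \<sigma> t \<in> carrier TP" if "\<sigma> permutes {1..n}" for \<sigma>
    using tensor_perm_closed[OF that t] .
  have "alternator A R n (a \<odot>\<^bsub>TP\<^esub> t) = (\<Oplus>\<^bsub>TP\<^esub> \<sigma>\<in>{\<sigma>. \<sigma> permutes {1..n}}.
      ?e \<otimes>\<^bsub>TP\<^esub> ([sign \<sigma>] \<cdot>\<^bsub>TP\<^esub> tensor_perm \<sigma> t))"
    unfolding alternator_def
  proof (rule T.finsum_cong')
    fix \<sigma> assume "\<sigma> \<in> {\<sigma>. \<sigma> permutes {1..n}}"
    then have \<sigma>: "\<sigma> permutes {1..n}" by simp
    show "[sign \<sigma>] \<cdot>\<^bsub>TP\<^esub> tensor_perm \<sigma> (a \<odot>\<^bsub>TP\<^esub> t) = ?e \<otimes>\<^bsub>TP\<^esub> ([sign \<sigma>] \<cdot>\<^bsub>TP\<^esub> tensor_perm \<sigma> t)"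
      using T.add_pow_rdistr_int[OF e cl[OF \<sigma>]] tensor_perm_smult[OF \<sigma> t a]
      by (simp only: tensor_power_simps(6))
  qed (use cl e in auto)
  also have "\<dots> = a \<odot>\<^bsub>TP\<^esub> alternator A R n t"
    unfolding alternator_def tensor_power_simps(6)
    by (rule T.finsum_rdistr[symmetric]) (use cl e finite_permutations in auto)
  finally show ?thesis .
qed

lemma alternator_unique:
  assumes closed: "\<And>t. t \<in> carrier TP \<Longrightarrow> f t \<in> carrier TP"
    and add: "\<And>s t. \<lbrakk>s \<in> carrier TP; t \<in> carrier TP\<rbrakk> \<Longrightarrow> f (s \<oplus>\<^bsub>TP\<^esub> t) = f s \<oplus>\<^bsub>TP\<^esub> f t"
    and f_pure: "\<And>x. (\<And>i. i \<in> {1..n} \<Longrightarrow> x i \<in> carrier R) \<Longrightarrow> f (pure_tensor A R n x) =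
      (\<Oplus>\<^bsub>TP\<^esub> \<sigma>\<in>{\<sigma>. \<sigma> permutes {1..n}}. [sign \<sigma>] \<cdot>\<^bsub>TP\<^esub> pure_tensor A R n (x \<circ> \<sigma>))"
    and t: "t \<in> carrier TP"
  shows "f t = alternator A R n t"
proof -
  have g_diff: "g (s \<ominus>\<^bsub>TP\<^esub> t) = g s \<ominus>\<^bsub>TP\<^esub> g t"
    if "\<And>t. t \<in> carrier TP \<Longrightarrow> g t \<in> carrier TP"
      and "\<And>s t. \<lbrakk>s \<in> carrier TP; t \<in> carrier TP\<rbrakk> \<Longrightarrow> g (s \<oplus>\<^bsub>TP\<^esub> t) = g s \<oplus>\<^bsub>TP\<^esub> g t"
      and "s \<in> carrier TP" "t \<in> carrier TP" for g s t
  proof -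
    have "g s = g ((s \<ominus>\<^bsub>TP\<^esub> t) \<oplus>\<^bsub>TP\<^esub> t)"
      using that(3,4) by (simp add: T.minus_eq T.a_assoc T.l_neg)
    also have "\<dots> = g (s \<ominus>\<^bsub>TP\<^esub> t) \<oplus>\<^bsub>TP\<^esub> g t"
      using that by simp
    finally show ?thesis
      using that(1)[of t] that(1)[of "s \<ominus>\<^bsub>TP\<^esub> t"] that(3,4)
      by (simp add: T.minus_eq[of "g s"] T.minus_eq[of _ "g t"] T.a_assoc T.r_neg)
  qed
  show ?thesis
    using t
  proof (induction t rule: tensor_power_induct)
    case (diff s t)
    then show ?case
      using g_diff[of f s t] g_diff[of "alternator A R n" s t] closed add
        alternator_closed alternator_add by simp
  next
    case (pure x)
    then show ?case by (simp only: alternator_pure_tensor f_pure)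
  qed
qed

end

end

theory Submission
  imports Defs
begin

text \<open>
  Let \<open>c\<^sub>i\<close> be the cycle with \<open>x\<^bsub>[i]\<^esub> = (x \<circ> c\<^sub>i)(n := 1)\<close>, whose sign is \<open>(-1)\<^bsup>n - i\<^esup>\<close>.
  Substituting \<open>\<pi> = c\<^sub>i \<circ> \<sigma>\<close> and \<open>i = \<pi> m\<close> turns the right-hand side into a sum over all
  positions \<open>m\<close> and permutations \<open>\<pi>\<close> of \<open>sign \<pi>\<close> times
  \<open>(x \<circ> \<pi>)(m := 1) \<cdot> \<phi>\<^sub>n(x\<^bsub>\<pi> m\<^esub>) \<cdot> y\<^sub>m\<close>. Here \<open>y\<^sub>m\<close> is the permuted \<open>y\<close>, which by partial
  symmetry depends on \<open>m\<close> only. For \<open>m \<noteq> n\<close> this product is unchanged when \<open>\<pi>\<close> is composed with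
  the transposition of \<open>m\<close> and \<open>n\<close>, so the signed sum over \<open>\<pi>\<close> vanishes; for \<open>m = n\<close> the product
  is \<open>(x \<circ> \<pi>) \<cdot> y\<close>, and the sum is \<open>\<alpha>(x) y\<close>.
\<close>

section \<open>Cycles and their signs\<close>

text \<open>For \<open>i \<le> n\<close> this is the cycle \<open>(i, i + 1, ..., n)\<close>, the
  identity when \<open>i = n\<close>. It sends \<open>n\<close> to \<open>i\<close>, so within
  \<open>{1..n}\<close> the tuple \<open>x \<circ> insertion_cycle n i\<close> has the later entries
  moved down by one position and \<open>x i\<close> at the end.\<close>

definition insertion_cycle :: "nat \<Rightarrow> nat \<Rightarrow> nat \<Rightarrow> nat"
  where "insertion_cycle n i k = (if k < i \<or> n < k then k else if k = n then i else k + 1)"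

lemma insertion_cycle_step:
  assumes "i < n"
  shows "insertion_cycle n i = transpose i (Suc i) \<circ> insertion_cycle n (Suc i)"
  using assms by (auto simp: fun_eq_iff insertion_cycle_def transpose_def)

text \<open>Peeling off adjacent transpositions writes the cycle as a product of
  \<open>n - i\<close> of them. The induction descends from \<open>n\<close>; the bound
  \<open>1 \<le> i\<close> stays inside the induction formula because the transposition of
  \<open>i\<close> and \<open>Suc i\<close> has to permute \<open>{1..n}\<close>.\<close>

lemma insertion_cycle_permutes_sign:
  assumes "i \<in> {1..n}"
  shows "insertion_cycle n i permutes {1..n} \<and> sign (insertion_cycle n i) = (- 1) ^ (n - i)"
proof -
  have "i \<le> n" using assms by simp
  then have "1 \<le> i \<longrightarrow> insertion_cycle n i permutes {1..n} \<and>
      sign (insertion_cycle n i) = (- 1) ^ (n - i)"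
  proof (induction i rule: inc_induct)
    case base
    have "insertion_cycle n n = id"
      by (auto simp: fun_eq_iff insertion_cycle_def)
    then show ?case by (simp only: permutes_id sign_id) simp
  next
    case (step i)
    show ?case
    proof
      assume i: "1 \<le> i"
      let ?t = "transpose i (Suc i)" and ?c = "insertion_cycle n (Suc i)"
      have t: "?t permutes {1..n}" using step.hyps i by (intro permutes_swap_id) auto
      have c: "?c permutes {1..n}" and s: "sign ?c = (- 1) ^ (n - Suc i)"
        using step.IH by auto
      have "sign (?t \<circ> ?c) = (- 1) * (- 1) ^ (n - Suc i)"
        using sign_compose[of ?t ?c] s permutation_swap_id[of i "Suc i"] permutes_imp_permutation[OF _ c]
        by (simp add: sign_swap_id)
      also have "\<dots> = (- 1) ^ (n - i)"
        using step.hyps by (simp flip: power_Suc add: Suc_diff_Suc)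
      finally show "insertion_cycle n i permutes {1..n} \<and>
          sign (insertion_cycle n i) = (- 1) ^ (n - i)"
        using permutes_compose[OF c t] insertion_cycle_step[of i n] step.hyps by simp
    qed
  qed
  then show ?thesis using assms by simp
qed

lemmas insertion_cycle_permutes = insertion_cycle_permutes_sign[THEN conjunct1]
lemmas sign_insertion_cycle = insertion_cycle_permutes_sign[THEN conjunct2]

lemma insertion_cycle_last: "i \<in> {1..n} \<Longrightarrow> insertion_cycle n i n = i"
  by (auto simp: insertion_cycle_def)

text \<open>Beyond \<open>n\<close> the left side is \<open>1\<close> and the right side
  \<open>x k\<close>, hence the bound on \<open>k\<close>; a pure tensor reads only the factors in
  \<open>{1..n}\<close>.\<close>

lemma omit_append_one_eq:
  assumes "i \<in> {1..n}" "k \<in> {1..n}"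
  shows "omit_append_one R n i x k = ((x \<circ> insertion_cycle n i)(n := \<one>\<^bsub>R\<^esub>)) k"
  using assms by (auto simp: omit_append_one_def insertion_cycle_def)

section \<open>Finite sums and signed sums over permutations\<close>

lemma (in abelian_monoid) finsum_swap:
  assumes "finite S" "finite S'" and "\<And>a b. \<lbrakk>a \<in> S; b \<in> S'\<rbrakk> \<Longrightarrow> f a b \<in> carrier G"
  shows "(\<Oplus>a\<in>S. \<Oplus>b\<in>S'. f a b) = (\<Oplus>b\<in>S'. \<Oplus>a\<in>S. f a b)"
  using assms(1,3)
proof (induction S)
  case empty
  then show ?case by (simp add: finsum_zero)
next
  case (insert s S)
  have "(\<Oplus>b\<in>S'. \<Oplus>a\<in>insert s S. f a b) = (\<Oplus>b\<in>S'. f s b \<oplus> (\<Oplus>a\<in>S. f a b))"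
    using insert by (intro finsum_cong' refl) (auto intro!: finsum_insert finsum_closed)
  also have "\<dots> = (\<Oplus>b\<in>S'. f s b) \<oplus> (\<Oplus>b\<in>S'. \<Oplus>a\<in>S. f a b)"
    using insert.prems by (intro finsum_addf) (auto intro!: finsum_closed)
  finally show ?case
    using insert by (subst finsum_insert) (auto intro!: finsum_closed)
qed

lemma (in abelian_group) add_pow_finsum:
  fixes k :: int
  assumes "finite S" and "\<And>a. a \<in> S \<Longrightarrow> f a \<in> carrier G"
  shows "[k] \<cdot> (\<Oplus>a\<in>S. f a) = (\<Oplus>a\<in>S. [k] \<cdot> f a)"
  using assms
proof (induction S)
  case empty
  then show ?case by (simp add: add.int_pow_one)
next
  case (insert s S)
  then have "(\<Oplus>a\<in>S. f a) \<in> carrier G" by (auto intro: finsum_closed)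
  with insert show ?case
    by (simp add: finsum_insert Pi_iff add.int_pow_distrib)
qed

text \<open>Right composition with \<open>\<tau>\<close> pairs each even permutation with an odd
  one, and the two terms of a pair cancel. Reindexing the whole sum would only show that it equals
  its own negative, which does not make it zero in the presence of 2-torsion; hence the split by
  sign.\<close>

lemma (in abelian_group) finsum_sign_eq_zero:
  assumes S: "finite S" and t: "\<tau> permutes S" "sign \<tau> = - 1"
    and f: "\<And>\<sigma>. \<sigma> permutes S \<Longrightarrow> f \<sigma> \<in> carrier G"
    and inv: "\<And>\<sigma>. \<sigma> permutes S \<Longrightarrow> f (\<sigma> \<circ> \<tau>) = f \<sigma>"
  shows "(\<Oplus>\<sigma>\<in>{\<sigma>. \<sigma> permutes S}. [sign \<sigma>] \<cdot> f \<sigma>) = \<zero>"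
proof -
  let ?E = "{\<sigma>. \<sigma> permutes S \<and> sign \<sigma> = 1}" and ?O = "{\<sigma>. \<sigma> permutes S \<and> sign \<sigma> = - 1}"
  have sg: "sign (\<sigma> \<circ> \<rho>) = sign \<sigma> * sign \<rho>" if "\<sigma> permutes S" "\<rho> permutes S" for \<sigma> \<rho>
    using that S by (simp add: sign_compose permutes_imp_permutation)
  have fin: "finite ?E" "finite ?O"
    using finite_permutations[OF S] by (auto intro: finite_subset[rotated])
  \<comment> \<open>\<open>\<tau>\<close> may fail to be an involution, so the even preimage of an
    odd \<open>\<sigma>\<close> is taken with the inverse of \<open>\<tau>\<close>, which has the
    same sign as \<open>\<tau>\<close>.\<close>
  have img: "?O = (\<lambda>\<sigma>. \<sigma> \<circ> \<tau>) ` ?E"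
  proof (intro equalityI subsetI)
    fix \<sigma> assume \<sigma>: "\<sigma> \<in> ?O"
    have i: "inv_into UNIV \<tau> permutes S" using t(1) by (rule permutes_inv)
    have "sign (inv_into UNIV \<tau>) = - 1"
      using t S by (simp add: sign_inverse permutes_imp_permutation)
    then have "\<sigma> \<circ> inv_into UNIV \<tau> \<in> ?E"
      using \<sigma> i sg[OF _ i, of \<sigma>] permutes_compose[OF i, of \<sigma>] by simp
    moreover have "\<sigma> = (\<sigma> \<circ> inv_into UNIV \<tau>) \<circ> \<tau>"
      by (simp add: o_assoc[symmetric] permutes_inv_o(2)[OF t(1)])
    ultimately show "\<sigma> \<in> (\<lambda>\<sigma>. \<sigma> \<circ> \<tau>) ` ?E" by blast
  qed (use t sg permutes_compose[OF t(1)] in auto)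
  have inj: "inj_on (\<lambda>\<sigma>. \<sigma> \<circ> \<tau>) ?E"
  proof (rule inj_onI)
    fix \<sigma> \<rho> assume "\<sigma> \<circ> \<tau> = \<rho> \<circ> \<tau>"
    then have "\<sigma> \<circ> \<tau> \<circ> inv_into UNIV \<tau> = \<rho> \<circ> \<tau> \<circ> inv_into UNIV \<tau>" by simp
    then show "\<sigma> = \<rho>" by (simp add: o_assoc[symmetric] permutes_inv_o(1)[OF t(1)])
  qed
  have split: "{\<sigma>. \<sigma> permutes S} = ?E \<union> ?O"
    using sign_cases by blast
  have "(\<Oplus>\<sigma>\<in>{\<sigma>. \<sigma> permutes S}. [sign \<sigma>] \<cdot> f \<sigma>) =
      (\<Oplus>\<sigma>\<in>?E. [sign \<sigma>] \<cdot> f \<sigma>) \<oplus> (\<Oplus>\<sigma>\<in>?O. [sign \<sigma>] \<cdot> f \<sigma>)"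
    unfolding split by (rule finsum_Un_disjoint[OF fin]) (use f in auto)
  also have "(\<Oplus>\<sigma>\<in>?O. [sign \<sigma>] \<cdot> f \<sigma>) = (\<Oplus>\<sigma>\<in>?E. [sign (\<sigma> \<circ> \<tau>)] \<cdot> f (\<sigma> \<circ> \<tau>))"
    unfolding img using f t permutes_compose[OF t(1)] by (intro finsum_reindex inj) auto
  also have "(\<Oplus>\<sigma>\<in>?E. [sign \<sigma>] \<cdot> f \<sigma>) \<oplus> \<dots> =
      (\<Oplus>\<sigma>\<in>?E. [sign \<sigma>] \<cdot> f \<sigma> \<oplus> [sign (\<sigma> \<circ> \<tau>)] \<cdot> f (\<sigma> \<circ> \<tau>))"
    using f t permutes_compose[OF t(1)] by (intro finsum_addf[symmetric]) auto
  also have "\<dots> = (\<Oplus>\<sigma>\<in>?E. \<zero>)"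
    using f t(2) sg[OF _ t(1)] inv
    by (intro finsum_cong') (auto simp: add.int_pow_neg r_neg)
  also have "\<dots> = \<zero>" by (simp add: finsum_zero)
  finally show ?thesis .
qed

lemma (in abelian_monoid) finsum_permutes_compose_left:
  assumes \<rho>: "\<rho> permutes S" and f: "\<And>\<sigma>. \<sigma> permutes S \<Longrightarrow> f \<sigma> \<in> carrier G"
  shows "(\<Oplus>\<sigma>\<in>{\<sigma>. \<sigma> permutes S}. f \<sigma>) = (\<Oplus>\<sigma>\<in>{\<sigma>. \<sigma> permutes S}. f (\<rho> \<circ> \<sigma>))"
proof -
  have inj: "inj_on ((\<circ>) \<rho>) {\<sigma>. \<sigma> permutes S}"
    by (intro inj_onI) (auto dest: fun.inj_map_strong simp: fun_eq_iff permutes_inj[OF \<rho>, THEN inj_eq])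
  have "(\<Oplus>\<sigma>\<in>{\<sigma>. \<sigma> permutes S}. f \<sigma>) = (\<Oplus>\<sigma>\<in>(\<circ>) \<rho> ` {\<sigma>. \<sigma> permutes S}. f \<sigma>)"
    using image_compose_permutations_left[OF \<rho>] by (simp add: setcompr_eq_image)
  also have "\<dots> = (\<Oplus>\<sigma>\<in>{\<sigma>. \<sigma> permutes S}. f (\<rho> \<circ> \<sigma>))"
    by (rule finsum_reindex[OF _ inj]) (use f permutes_compose[OF _ \<rho>] in auto)
  finally show ?thesis .
qed

section \<open>Permuted tensors and partial symmetry\<close>

text \<open>Permutations act on tuples by precomposition, which is a right action; this reverses the
  order of the factors.\<close>

lemma tensor_perm_comp: "tensor_perm \<sigma> (tensor_perm \<tau> t) = tensor_perm (\<tau> \<circ> \<sigma>) t"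
  unfolding tensor_perm_def image_image frag_perm_comp ..

text \<open>The composite of \<open>\<sigma>\<close> with the transposition of \<open>m\<close> and
  \<open>n\<close> fixes \<open>n\<close>, hence lies in the symmetric group that fixes
  \<open>y\<close>. So the action of \<open>\<sigma>\<close> on \<open>y\<close> depends only on the
  position \<open>m\<close> that \<open>\<sigma>\<close> sends to \<open>n\<close>, and the
  transposition serves as representative.\<close>

lemma tensor_perm_partial_symmetric:
  assumes y: "y \<in> partial_symmetric_tensors A R n" and \<sigma>: "\<sigma> permutes {1..n}"
    and m: "m \<in> {1..n}" "\<sigma> m = n"
  shows "tensor_perm \<sigma> y = tensor_perm (transpose m n) y"
proof -
  let ?\<rho> = "\<sigma> \<circ> transpose m n"
  have "transpose m n permutes {1..n}"
    using m by (intro permutes_swap_id) auto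
  then have "?\<rho> permutes {1..n}"
    using \<sigma> by (rule permutes_compose)
  moreover have "?\<rho> n = n" using m by simp
  moreover have "k \<in> {1..n - 1}" if "k \<in> {1..n}" "k \<noteq> n" for k
    using that by auto
  ultimately have "?\<rho> permutes {1..n - 1}"
    by (metis (no_types, lifting) DiffE permutes_superset)
  then have "tensor_perm ?\<rho> y = y"
    using y by (simp add: partial_symmetric_tensors_def)
  then have "tensor_perm (transpose m n) y = tensor_perm (?\<rho> \<circ> transpose m n) y"
    by (metis tensor_perm_comp)
  then show ?thesis by (simp add: o_assoc[symmetric])
qed

section \<open>The expansion of \<open>\<alpha>(x) y\<close>\<close>

theorem proposition1p7:
  fixes A :: "('a, 'm) ring_scheme" and R :: "('a, 'r, 'k) module_scheme"
    and n :: nat and x :: "nat \<Rightarrow> 'r" and y :: "((nat \<Rightarrow> 'r) \<Rightarrow>\<^sub>0 int) set"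
  defines "T \<equiv> tensor_power A R n"
  assumes "algebra A R" and "n \<ge> 1"
    and "\<And>i. i \<in> {1..n} \<Longrightarrow> x i \<in> carrier R"
    and "y \<in> partial_symmetric_tensors A R n"
  shows "alternator A R n (pure_tensor A R n x) \<otimes>\<^bsub>T\<^esub> y =
    (\<Oplus>\<^bsub>T\<^esub> i\<in>{1..n}. [((- 1 :: int) ^ (n - i))] \<cdot>\<^bsub>T\<^esub>
       (alternator A R n (pure_tensor A R n (omit_append_one R n i x) \<otimes>\<^bsub>T\<^esub> y)
          \<otimes>\<^bsub>T\<^esub> coprojection A R n n (x i)))"
proof -
  note alg = assms(2) and n = assms(3) and x = assms(4) and y = assms(5)
  interpret R: algebra A R by (rule alg)
  interpret T: cring T unfolding T_def by (rule tensor_power_cring[OF alg n])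
  let ?S = "{\<sigma>. \<sigma> permutes {1..n}}"
  let ?P = "pure_tensor A R n" and ?\<phi> = "coprojection A R n n"
  note perm_closed = tensor_perm_closed[OF alg n, folded T_def]
  note pure_closed = pure_tensor_closed[OF alg n, folded T_def]
  have nn: "n \<in> {1..n}" using n by simp
  have yT: "y \<in> carrier T" using y by (simp add: partial_symmetric_tensors_def T_def)
  have \<phi>T: "?\<phi> r \<in> carrier T" if "r \<in> carrier R" for r
    unfolding coprojection_def using that by (intro pure_closed) auto
  have fin: "finite ?S" by (rule finite_permutations) simp
  have \<sigma>_mem: "\<sigma> k \<in> {1..n}" if "\<sigma> permutes {1..n}" "k \<in> {1..n}" for \<sigma> k
    using that(2) permutes_in_image[OF that(1)] by simp
  have x\<sigma>: "x (\<sigma> k) \<in> carrier R" if "\<sigma> permutes {1..n}" "k \<in> {1..n}" for \<sigma> k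
    using x \<sigma>_mem that by blast
  \<comment> \<open>Here \<open>m\<close> is the position that receives the inserted
    \<open>1\<close>, and \<open>x (\<pi> m)\<close> is the entry that it displaces. The middle
    factor is free of \<open>\<pi>\<close>.\<close>
  define Q where "Q m \<pi> = ?P ((x \<circ> \<pi>)(m := \<one>\<^bsub>R\<^esub>)) \<otimes>\<^bsub>T\<^esub> tensor_perm (transpose m n) y
    \<otimes>\<^bsub>T\<^esub> ?\<phi> (x (\<pi> m))" for m \<pi>
  have tr: "transpose m n permutes {1..n}" if "m \<in> {1..n}" for m
    using that nn by (rule permutes_swap_id)
  have QP: "?P ((x \<circ> \<pi>)(m := \<one>\<^bsub>R\<^esub>)) \<in> carrier T" if "\<pi> permutes {1..n}" for m \<pi>
    using x\<sigma>[OF that] by (intro pure_closed) auto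
  have QT: "Q m \<pi> \<in> carrier T" if "m \<in> {1..n}" "\<pi> permutes {1..n}" for m \<pi>
    unfolding Q_def
    using QP[OF that(2)] perm_closed[OF tr yT] \<phi>T[OF x\<sigma>] that
    by (intro T.m_closed) auto
  \<comment> \<open>Merging the two pure tensors puts the displaced entry back, now at factor
    \<open>n\<close>: for \<open>m \<noteq> n\<close> factor \<open>m\<close> is \<open>1\<close>
    and factor \<open>n\<close> is a product of two entries, while for \<open>m = n\<close> the
    tuple \<open>x \<circ> \<pi>\<close> is restored.\<close>
  have Q_eq: "Q m \<pi> = ?P (\<lambda>k. ((x \<circ> \<pi>)(m := \<one>\<^bsub>R\<^esub>)) k \<otimes>\<^bsub>R\<^esub> ((\<lambda>_. \<one>\<^bsub>R\<^esub>)(n := x (\<pi> m))) k)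
      \<otimes>\<^bsub>T\<^esub> tensor_perm (transpose m n) y" if m: "m \<in> {1..n}" and \<pi>: "\<pi> permutes {1..n}" for m \<pi>
  proof -
    have ac: "a \<otimes>\<^bsub>T\<^esub> b \<otimes>\<^bsub>T\<^esub> d = a \<otimes>\<^bsub>T\<^esub> d \<otimes>\<^bsub>T\<^esub> b"
      if "a \<in> carrier T" "b \<in> carrier T" "d \<in> carrier T" for a b d
      using that by (simp add: T.m_assoc T.m_comm[of b d])
    have "Q m \<pi> = ?P ((x \<circ> \<pi>)(m := \<one>\<^bsub>R\<^esub>)) \<otimes>\<^bsub>T\<^esub> ?\<phi> (x (\<pi> m)) \<otimes>\<^bsub>T\<^esub> tensor_perm (transpose m n) y"
      unfolding Q_def by (rule ac[OF QP[OF \<pi>] perm_closed[OF tr[OF m] yT] \<phi>T[OF x\<sigma>[OF \<pi> m]]])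
    also have "?P ((x \<circ> \<pi>)(m := \<one>\<^bsub>R\<^esub>)) \<otimes>\<^bsub>T\<^esub> ?\<phi> (x (\<pi> m)) =
        ?P (\<lambda>k. ((x \<circ> \<pi>)(m := \<one>\<^bsub>R\<^esub>)) k \<otimes>\<^bsub>R\<^esub> ((\<lambda>_. \<one>\<^bsub>R\<^esub>)(n := x (\<pi> m))) k)"
      unfolding coprojection_def T_def
      using x\<sigma>[OF \<pi>] m by (intro pure_tensor_mult[OF alg n]) auto
    finally show ?thesis .
  qed
  have row: "[((- 1 :: int) ^ (n - i))] \<cdot>\<^bsub>T\<^esub>
       (alternator A R n (?P (omit_append_one R n i x) \<otimes>\<^bsub>T\<^esub> y) \<otimes>\<^bsub>T\<^esub> ?\<phi> (x i)) =
      (\<Oplus>\<^bsub>T\<^esub> \<pi>\<in>?S. [sign \<pi>] \<cdot>\<^bsub>T\<^esub> Q (inv_into UNIV \<pi> i) \<pi>)" if i: "i \<in> {1..n}" for i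
  proof -
    let ?c = "insertion_cycle n i" and ?e = "(- 1 :: int) ^ (n - i)"
    let ?o = "?P (omit_append_one R n i x)"
    note c = insertion_cycle_permutes[OF i]
    have oc: "?o = ?P ((x \<circ> ?c)(n := \<one>\<^bsub>R\<^esub>))"
      using omit_append_one_eq[OF i] by (intro pure_tensor_cong[OF alg n]) blast
    have oT: "?o \<in> carrier T" unfolding oc by (rule QP[OF c])
    have oyT: "?o \<otimes>\<^bsub>T\<^esub> y \<in> carrier T" using oT yT by simp
    have xi: "?\<phi> (x i) \<in> carrier T" using \<phi>T x i by blast
    define g where "g \<sigma> = tensor_perm \<sigma> (?o \<otimes>\<^bsub>T\<^esub> y) \<otimes>\<^bsub>T\<^esub> ?\<phi> (x i)" for \<sigma>
    have gT: "g \<sigma> \<in> carrier T" if "\<sigma> permutes {1..n}" for \<sigma>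
      unfolding g_def using perm_closed[OF that oyT] xi by simp
    have g: "g \<sigma> = Q (inv_into UNIV (?c \<circ> \<sigma>) i) (?c \<circ> \<sigma>)" if \<sigma>: "\<sigma> permutes {1..n}" for \<sigma>
    proof -
      \<comment> \<open>The \<open>1\<close> at the last factor of
        \<open>x\<^sub>[\<^sub>i\<^sub>]\<close> is carried by \<open>\<sigma>\<close> to the
        position \<open>m\<close>. Since \<open>?c\<close> sends \<open>n\<close> to
        \<open>i\<close>, the composite \<open>?c \<circ> \<sigma>\<close> sends \<open>m\<close> to
        \<open>i\<close>, so \<open>m\<close> is determined by this composite and
        \<open>i\<close>.\<close>
      define m where "m = inv_into UNIV \<sigma> n"
      have m: "\<sigma> m = n" "m \<in> {1..n}"
        unfolding m_def using permutes_inverses(1)[OF \<sigma>] \<sigma>_mem[OF permutes_inv[OF \<sigma>] nn] by auto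
      have c\<sigma>: "?c \<circ> \<sigma> permutes {1..n}" using \<sigma> c by (rule permutes_compose)
      have cm: "(?c \<circ> \<sigma>) m = i" using m insertion_cycle_last[OF i] by simp
      then have im: "inv_into UNIV (?c \<circ> \<sigma>) i = m"
        using permutes_inverses(2)[OF c\<sigma>, of m] by simp
      \<comment> \<open>The permutation acts on the product inside the alternator only; the factor
        \<open>?\<phi> (x i)\<close> stands outside and is not moved.\<close>
      have "tensor_perm \<sigma> (?o \<otimes>\<^bsub>T\<^esub> y) = tensor_perm \<sigma> ?o \<otimes>\<^bsub>T\<^esub> tensor_perm \<sigma> y"
        using ring_hom_mult[OF tensor_perm_ring_hom[OF alg n \<sigma>]] oT yT unfolding T_def by blast
      also have "tensor_perm \<sigma> ?o = ?P ((x \<circ> (?c \<circ> \<sigma>))(m := \<one>\<^bsub>R\<^esub>))"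
        unfolding oc tensor_perm_pure[OF alg n \<sigma>] upd_comp_perm[OF alg n \<sigma>] m_def o_assoc ..
      also have "tensor_perm \<sigma> y = tensor_perm (transpose m n) y"
        by (rule tensor_perm_partial_symmetric[OF y \<sigma> m(2,1)])
      finally show ?thesis
        unfolding g_def im Q_def cm by (simp only:)
    qed
    have Qi: "Q (inv_into UNIV \<pi> i) \<pi> \<in> carrier T" if "\<pi> permutes {1..n}" for \<pi>
      using QT[OF \<sigma>_mem[OF permutes_inv[OF that] i] that] .
    have "alternator A R n (?o \<otimes>\<^bsub>T\<^esub> y) \<otimes>\<^bsub>T\<^esub> ?\<phi> (x i) =
        (\<Oplus>\<^bsub>T\<^esub> \<sigma>\<in>?S. [sign \<sigma>] \<cdot>\<^bsub>T\<^esub> tensor_perm \<sigma> (?o \<otimes>\<^bsub>T\<^esub> y) \<otimes>\<^bsub>T\<^esub> ?\<phi> (x i))"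
      unfolding alternator_def T_def[symmetric]
      using fin xi perm_closed[OF _ oyT] by (intro T.finsum_ldistr) auto
    also have "\<dots> = (\<Oplus>\<^bsub>T\<^esub> \<sigma>\<in>?S. [sign \<sigma>] \<cdot>\<^bsub>T\<^esub> g \<sigma>)"
      unfolding g_def using xi perm_closed[OF _ oyT]
      by (intro T.finsum_cong') (auto simp: T.add_pow_ldistr_int)
    finally have "[?e] \<cdot>\<^bsub>T\<^esub> (alternator A R n (?o \<otimes>\<^bsub>T\<^esub> y) \<otimes>\<^bsub>T\<^esub> ?\<phi> (x i)) =
        [?e] \<cdot>\<^bsub>T\<^esub> (\<Oplus>\<^bsub>T\<^esub> \<sigma>\<in>?S. [sign \<sigma>] \<cdot>\<^bsub>T\<^esub> g \<sigma>)"
      by simp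
    also have "\<dots> = (\<Oplus>\<^bsub>T\<^esub> \<sigma>\<in>?S. [?e] \<cdot>\<^bsub>T\<^esub> ([sign \<sigma>] \<cdot>\<^bsub>T\<^esub> g \<sigma>))"
      using fin gT by (intro T.add_pow_finsum) auto
    \<comment> \<open>The coefficient \<open>(- 1) ^ (n - i)\<close> is the sign of
      \<open>?c\<close> and is absorbed into the sign of the composite.\<close>
    also have "\<dots> = (\<Oplus>\<^bsub>T\<^esub> \<sigma>\<in>?S. [sign (?c \<circ> \<sigma>)] \<cdot>\<^bsub>T\<^esub> Q (inv_into UNIV (?c \<circ> \<sigma>) i) (?c \<circ> \<sigma>))"
    proof (rule T.finsum_cong')
      fix \<sigma> assume "\<sigma> \<in> ?S"
      then have \<sigma>: "\<sigma> permutes {1..n}" by simp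
      have "sign (?c \<circ> \<sigma>) = ?e * sign \<sigma>"
        using sign_compose[of ?c \<sigma>] c \<sigma> sign_insertion_cycle[OF i]
        by (simp add: permutes_imp_permutation[of "{1..n}"] del: One_nat_def)
      then show "[?e] \<cdot>\<^bsub>T\<^esub> ([sign \<sigma>] \<cdot>\<^bsub>T\<^esub> g \<sigma>) =
          [sign (?c \<circ> \<sigma>)] \<cdot>\<^bsub>T\<^esub> Q (inv_into UNIV (?c \<circ> \<sigma>) i) (?c \<circ> \<sigma>)"
        using T.add.int_pow_pow[OF gT[OF \<sigma>], of ?e "sign \<sigma>"] g[OF \<sigma>] by (simp add: mult.commute)
    qed (use Qi permutes_compose[OF _ c] in auto)
    also have "\<dots> = (\<Oplus>\<^bsub>T\<^esub> \<pi>\<in>?S. [sign \<pi>] \<cdot>\<^bsub>T\<^esub> Q (inv_into UNIV \<pi> i) \<pi>)"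
      by (rule T.finsum_permutes_compose_left[OF c, symmetric]) (use Qi in auto)
    finally show ?thesis .
  qed
  have vanish: "(\<Oplus>\<^bsub>T\<^esub> \<pi>\<in>?S. [sign \<pi>] \<cdot>\<^bsub>T\<^esub> Q m \<pi>) = \<zero>\<^bsub>T\<^esub>" if m: "m \<in> {1..n}" "m \<noteq> n" for m
  proof (rule T.finsum_sign_eq_zero[of _ "transpose m n"])
    show "sign (transpose m n) = - 1" using m by (simp add: sign_swap_id)
    fix \<pi> :: "nat \<Rightarrow> nat" assume \<pi>: "\<pi> permutes {1..n}"
    show "Q m \<pi> \<in> carrier T" by (rule QT[OF m(1) \<pi>])
    have \<pi>t: "\<pi> \<circ> transpose m n permutes {1..n}" by (rule permutes_compose[OF tr[OF m(1)] \<pi>])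
    \<comment> \<open>Both tuples have \<open>1\<close> at \<open>m\<close>, and at \<open>n\<close>
      the product of \<open>x (\<pi> m)\<close> and \<open>x (\<pi> n)\<close> in opposite orders,
      so commutativity of \<open>R\<close> makes them agree.\<close>
    have "?P (\<lambda>k. ((x \<circ> (\<pi> \<circ> transpose m n))(m := \<one>\<^bsub>R\<^esub>)) k \<otimes>\<^bsub>R\<^esub>
          ((\<lambda>_. \<one>\<^bsub>R\<^esub>)(n := x ((\<pi> \<circ> transpose m n) m))) k) =
        ?P (\<lambda>k. ((x \<circ> \<pi>)(m := \<one>\<^bsub>R\<^esub>)) k \<otimes>\<^bsub>R\<^esub> ((\<lambda>_. \<one>\<^bsub>R\<^esub>)(n := x (\<pi> m))) k)"
      using x\<sigma>[OF \<pi>] m nn R.m_comm[OF x\<sigma>[OF \<pi> m(1)] x\<sigma>[OF \<pi> nn]]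
      by (intro pure_tensor_cong[OF alg n]) (auto simp: transpose_def)
    then show "Q m (\<pi> \<circ> transpose m n) = Q m \<pi>"
      by (simp only: Q_eq[OF m(1) \<pi>] Q_eq[OF m(1) \<pi>t])
  qed (use tr m in auto)
  have last: "(\<Oplus>\<^bsub>T\<^esub> \<pi>\<in>?S. [sign \<pi>] \<cdot>\<^bsub>T\<^esub> Q n \<pi>) = alternator A R n (?P x) \<otimes>\<^bsub>T\<^esub> y"
  proof -
    have Px: "?P (x \<circ> \<pi>) \<in> carrier T" if "\<pi> permutes {1..n}" for \<pi>
      using x\<sigma>[OF that] by (intro pure_closed) auto
    \<comment> \<open>For \<open>m = n\<close> the transposition in \<open>Q\<close> is the
      identity, so \<open>y\<close> appears unpermuted.\<close>
    have "tensor_perm id y = y" by (simp add: tensor_perm_def frag_perm_id)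
    moreover have "?P (\<lambda>k. ((x \<circ> \<pi>)(n := \<one>\<^bsub>R\<^esub>)) k \<otimes>\<^bsub>R\<^esub> ((\<lambda>_. \<one>\<^bsub>R\<^esub>)(n := x (\<pi> n))) k) = ?P (x \<circ> \<pi>)"
      if "\<pi> permutes {1..n}" for \<pi>
      using x\<sigma>[OF that] by (intro pure_tensor_cong[OF alg n]) auto
    ultimately have Qn: "Q n \<pi> = ?P (x \<circ> \<pi>) \<otimes>\<^bsub>T\<^esub> y" if "\<pi> permutes {1..n}" for \<pi>
      using Q_eq[OF nn that] that by simp
    have alt: "alternator A R n (?P x) = (\<Oplus>\<^bsub>T\<^esub> \<pi>\<in>?S. [sign \<pi>] \<cdot>\<^bsub>T\<^esub> ?P (x \<circ> \<pi>))"
      unfolding T_def by (rule alternator_pure_tensor[OF alg n]) (rule x)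
    have "alternator A R n (?P x) \<otimes>\<^bsub>T\<^esub> y = (\<Oplus>\<^bsub>T\<^esub> \<pi>\<in>?S. [sign \<pi>] \<cdot>\<^bsub>T\<^esub> ?P (x \<circ> \<pi>) \<otimes>\<^bsub>T\<^esub> y)"
      unfolding alt
      using fin yT Px by (intro T.finsum_ldistr) auto
    also have "\<dots> = (\<Oplus>\<^bsub>T\<^esub> \<pi>\<in>?S. [sign \<pi>] \<cdot>\<^bsub>T\<^esub> Q n \<pi>)"
      using yT Px QT[OF nn] Qn by (intro T.finsum_cong') (auto simp: T.add_pow_ldistr_int)
    finally show ?thesis by simp
  qed
  have Qi: "Q (inv_into UNIV \<pi> i) \<pi> \<in> carrier T" if "\<pi> permutes {1..n}" "i \<in> {1..n}" for \<pi> i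
    using QT[OF \<sigma>_mem[OF permutes_inv[OF that(1)] that(2)] that(1)] .
  have sumT: "(\<Oplus>\<^bsub>T\<^esub> \<pi>\<in>?S. [sign \<pi>] \<cdot>\<^bsub>T\<^esub> Q m \<pi>) \<in> carrier T" if "m \<in> {1..n}" for m
    using QT[OF that] by (intro T.finsum_closed) auto
  have "(\<Oplus>\<^bsub>T\<^esub> i\<in>{1..n}. [((- 1 :: int) ^ (n - i))] \<cdot>\<^bsub>T\<^esub>
       (alternator A R n (?P (omit_append_one R n i x) \<otimes>\<^bsub>T\<^esub> y) \<otimes>\<^bsub>T\<^esub> ?\<phi> (x i))) =
      (\<Oplus>\<^bsub>T\<^esub> i\<in>{1..n}. \<Oplus>\<^bsub>T\<^esub> \<pi>\<in>?S. [sign \<pi>] \<cdot>\<^bsub>T\<^esub> Q (inv_into UNIV \<pi> i) \<pi>)"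
    using Qi row by (intro T.finsum_cong') (auto intro!: T.finsum_closed)
  \<comment> \<open>The substitution \<open>i = \<pi> m\<close> depends on \<open>\<pi>\<close>, so
    the sum over \<open>i\<close> is first made the inner one; after the substitution the sums are
    exchanged back to isolate each position \<open>m\<close>.\<close>
  also have "\<dots> = (\<Oplus>\<^bsub>T\<^esub> \<pi>\<in>?S. \<Oplus>\<^bsub>T\<^esub> i\<in>{1..n}. [sign \<pi>] \<cdot>\<^bsub>T\<^esub> Q (inv_into UNIV \<pi> i) \<pi>)"
    using fin Qi by (intro T.finsum_swap) auto
  also have "\<dots> = (\<Oplus>\<^bsub>T\<^esub> \<pi>\<in>?S. \<Oplus>\<^bsub>T\<^esub> m\<in>{1..n}. [sign \<pi>] \<cdot>\<^bsub>T\<^esub> Q m \<pi>)"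
  proof (rule T.finsum_cong')
    fix \<pi> assume "\<pi> \<in> ?S"
    then have \<pi>: "\<pi> permutes {1..n}" by simp
    have "(\<Oplus>\<^bsub>T\<^esub> i\<in>\<pi> ` {1..n}. [sign \<pi>] \<cdot>\<^bsub>T\<^esub> Q (inv_into UNIV \<pi> i) \<pi>) =
        (\<Oplus>\<^bsub>T\<^esub> m\<in>{1..n}. [sign \<pi>] \<cdot>\<^bsub>T\<^esub> Q (inv_into UNIV \<pi> (\<pi> m)) \<pi>)"
      using QT[OF _ \<pi>] permutes_inj_on[OF \<pi>] by (intro T.finsum_reindex) auto
    then show "(\<Oplus>\<^bsub>T\<^esub> i\<in>{1..n}. [sign \<pi>] \<cdot>\<^bsub>T\<^esub> Q (inv_into UNIV \<pi> i) \<pi>) =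
        (\<Oplus>\<^bsub>T\<^esub> m\<in>{1..n}. [sign \<pi>] \<cdot>\<^bsub>T\<^esub> Q m \<pi>)"
      by (simp only: permutes_image[OF \<pi>] permutes_inverses(2)[OF \<pi>])
  qed (use QT in \<open>auto intro!: T.finsum_closed\<close>)
  also have "\<dots> = (\<Oplus>\<^bsub>T\<^esub> m\<in>{1..n}. \<Oplus>\<^bsub>T\<^esub> \<pi>\<in>?S. [sign \<pi>] \<cdot>\<^bsub>T\<^esub> Q m \<pi>)"
    using fin QT by (intro T.finsum_swap) auto
  also have "\<dots> = (\<Oplus>\<^bsub>T\<^esub> m\<in>{1..n}. if n = m then \<Oplus>\<^bsub>T\<^esub> \<pi>\<in>?S. [sign \<pi>] \<cdot>\<^bsub>T\<^esub> Q m \<pi> else \<zero>\<^bsub>T\<^esub>)"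
    using vanish sumT by (intro T.finsum_cong') auto
  also have "\<dots> = (\<Oplus>\<^bsub>T\<^esub> \<pi>\<in>?S. [sign \<pi>] \<cdot>\<^bsub>T\<^esub> Q n \<pi>)"
    using nn sumT by (intro T.finsum_singleton) auto
  finally show ?thesis unfolding last ..
qed

end
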